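(* The set of stable $T$-adic entire series in $1+s\mathbb{Z}_q[[T]][[s]]$ is closed under multiplication and under the tensor operation $\otimes$. That is, if $A(s,T),B(s,T)\in 1+s\mathbb{Z}_q[[T]][[s]]$ are stable $T$-adic entire series, then so are $A(s,T)B(s,T)$ and $A\otimes B(s,T)$.
   Context: $p$ is a prime, $q$ a power of $p$, $\mathbb{Z}_q=W(\mathbb{F}_q)$, $\mathbb{C}_p$ the completion of an algebraic closure of $\mathbb{Q}_p$ (containing $\mathbb{Z}_q$). A series $A(s,T)=\sum_{i\ge0} a_i(T)s^i$ with $a_i\in\mathbb{Z}_q[[T]]$ is $T$-adic entire in $s$ if $\mathrm{ord}_T(a_i)/i\to\infty$. Its $T$-adic Newton polygon is the lower convex hull of the points $(i,\mathrm{ord}_T(a_i(T)))$. For $t\in\mathbb{C}_p$ with $0\neq|t|_p<1$, the $t$-adic Newton polygon of $A(s,t)=\sum_i a_i(t)s^i$ is the lower convex hull of the points $(i,\mathrm{ord}_t(a_i(t)))$, where $\mathrm{ord}_t$ is the valuation on $\mathbb{C}_p$ with $\mathrm{ord}_t(t)=1$. A $T$-adic entire series $A(s,T)\in 1+s\mathbb{Z}_q[[T]][[s]]$ is stable if the $t$-adic Newton polygon of $A(s,t)$ equals the $T$-adic Newton polygon of $A(s,T)$ for every $t\in\mathbb{C}_p$ with $0\neq|t|_p<1$. Tensor operation: if $A(s,T)=\exp(-\sum_{k\ge1}a_k(T)\frac{s^k}{k})$ and $B(s,T)=\exp(-\sum_{k\ge1}b_k(T)\frac{s^k}{k})$, then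 $A\otimes B(s,T)=\exp(-\sum_{k\ge1}a_k(T)b_k(T)\frac{s^k}{k})$. *)

theory Defs
  imports
    "HOL-Analysis.Analysis"
    "HOL-Computational_Algebra.Computational_Algebra"
    "HOL-Algebra.QuotRing"
begin

section \<open>The field of p-adic complex numbers and its subring of Witt vectors\<close>

text \<open>
  The type \<open>'c\<close> is, as a valued field, the completion of an algebraic closure of the p-adic
  numbers: it is complete for a non-archimedean absolute value that restricts to the p-adic one,
  so the closure of the rationals is the field of p-adic numbers; the elements algebraic over
  that closure form an algebraically closed field; and they are dense.  The absolute value is
  normalised by |p| = 1/p.  These properties determine \<open>'c\<close> up to isometric isomorphism.
\<close>

definition algebraic_over :: "'c::field set \<Rightarrow> 'c set" where
  "algebraic_over F = {x. \<exists>f. f \<noteq> 0 \<and> (\<forall>i. coeff f i \<in> F) \<and> poly f x = 0}"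

definition absv :: "'c::{zero, metric_space} \<Rightarrow> real" where
  "absv x = dist x 0"

locale padic_complex_field =
  fixes p :: nat
  assumes prime_p: "prime p"
    and dist_absv: "dist x y = absv (x - y :: 'c::{field_char_0, complete_space})"
    and absv_mult: "absv (x * y :: 'c) = absv x * absv y"
    and absv_ultrametric: "absv (x + y :: 'c) \<le> max (absv x) (absv y)"
    and absv_of_nat: "n \<noteq> 0 \<Longrightarrow> absv (of_nat n :: 'c) = 1 / real p ^ multiplicity p n"
    and algebraically_closed:
      "\<lbrakk>\<And>i. coeff f i \<in> algebraic_over (closure (\<rat> :: 'c set)); degree f > 0\<rbrakk>
        \<Longrightarrow> \<exists>x \<in> algebraic_over (closure \<rat>). poly f x = 0"
    and algebraic_dense: "closure (algebraic_over (closure (\<rat> :: 'c set))) = UNIV"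

definition subring_of :: "'c::field set \<Rightarrow> 'c ring" where
  "subring_of R = \<lparr>carrier = R, mult = (*), one = 1, zero = 0, add = (+)\<rparr>"

text \<open>
  The ring of Witt vectors of the field with q elements is the p-torsion-free, p-adically complete
  and separated ring whose reduction modulo p is that field.  For a subring of the closed unit
  ball whose reduction modulo p is a field, elements outside (p) have absolute value 1, so the
  metric topology is the p-adic one and p-adic completeness means being closed.  There is exactly
  one such subring for every power q of p.
\<close>

definition is_Witt_subring :: "nat \<Rightarrow> nat \<Rightarrow> 'c::{field, metric_space} set \<Rightarrow> bool" where
  "is_Witt_subring p q R \<longleftrightarrow>
     cring (subring_of R) \<and> R \<subseteq> {x. absv x \<le> 1} \<and> closed R \<and>
     field (subring_of R Quot PIdl\<^bsub>subring_of R\<^esub> (of_nat p)) \<and>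
     card (carrier (subring_of R Quot PIdl\<^bsub>subring_of R\<^esub> (of_nat p))) = q"


section \<open>Newton polygons and stable series\<close>

text \<open>
  The lower convex hull of the points \<open>(i, v i)\<close>, as the function of the abscissa giving its
  height.  Coefficients of infinite valuation contribute no point, and the height is \<open>\<infinity>\<close> at
  abscissae outside the projection of the convex hull (the infimum of the empty set).
\<close>

definition newton_polygon :: "(nat \<Rightarrow> ereal) \<Rightarrow> real \<Rightarrow> ereal" where
  "newton_polygon v x =
     (INF y \<in> {y. (x, y) \<in> convex hull {(real i, y) | i y. v i = ereal y}}. ereal y)"

definition ord_T :: "'c::zero fps \<Rightarrow> ereal" where
  "ord_T f = (if f = 0 then \<infinity> else ereal (real (subdegree f)))"

definition ord_at :: "'c::{zero, metric_space} \<Rightarrow> 'c \<Rightarrow> ereal" where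
  "ord_at t x = (if x = 0 then \<infinity> else ereal (ln (absv x) / ln (absv t)))"

definition eval_at :: "'c::{comm_semiring_1, topological_space} \<Rightarrow> 'c fps \<Rightarrow> 'c" where
  "eval_at t f = (\<Sum>n. fps_nth f n * t ^ n)"

text \<open>
  A series in s over power series in T has type \<open>'c fps fps\<close>: the outer variable is s and the
  inner one is T.
\<close>

definition one_plus_s_series :: "'c::comm_ring_1 set \<Rightarrow> 'c fps fps set" where
  "one_plus_s_series R =
     {A. fps_nth A 0 = 1 \<and> (\<forall>i n. fps_nth (fps_nth A i) n \<in> R)}"

definition T_adic_entire :: "'c::comm_ring_1 fps fps \<Rightarrow> bool" where
  "T_adic_entire A \<longleftrightarrow> (\<lambda>i. ord_T (fps_nth A i) / ereal (real i)) \<longlonglongrightarrow> \<infinity>"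

definition stable_series ::
  "'c::{comm_ring_1, metric_space} set \<Rightarrow> 'c fps fps \<Rightarrow> bool" where
  "stable_series R A \<longleftrightarrow>
     A \<in> one_plus_s_series R \<and> T_adic_entire A \<and>
     (\<forall>t. t \<noteq> 0 \<and> absv t < 1 \<longrightarrow>
        newton_polygon (\<lambda>i. ord_at t (eval_at t (fps_nth A i))) =
        newton_polygon (\<lambda>i. ord_T (fps_nth A i)))"


section \<open>The tensor operation\<close>

text \<open>
  \<open>exp_series a\<close> is the exponential of \<open>- (\<Sum>k\<ge>1. a k * s ^ k / k)\<close>; the value \<open>a 0\<close> is
  irrelevant because \<open>1 / of_nat 0 = 0\<close>.  The library's \<open>fps_exp\<close> needs a field of coefficients.
\<close>

definition exp_series :: "(nat \<Rightarrow> 'c::field_char_0 fps) \<Rightarrow> 'c fps fps" where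
  "exp_series a =
     Abs_fps (\<lambda>n. fps_const (1 / fact n)) oo
       (- Abs_fps (\<lambda>k. fps_const (1 / of_nat k) * a k))"

definition exp_coeffs :: "'c::field_char_0 fps fps \<Rightarrow> nat \<Rightarrow> 'c fps" where
  "exp_coeffs A = (THE a. a 0 = 0 \<and> A = exp_series a)"

definition tensor :: "'c::field_char_0 fps fps \<Rightarrow> 'c fps fps \<Rightarrow> 'c fps fps" where
  "tensor A B = exp_series (\<lambda>k. exp_coeffs A k * exp_coeffs B k)"

text \<open>
  Every series with constant term 1 has exponential coordinates, and the tensor operation is
  computed from any choice of them.
\<close>

lemma exp_series_nth_0: "fps_nth (exp_series a) 0 = 1"
  by (simp add: exp_series_def)

lemma fps_deriv_exp_series:
  "fps_deriv (exp_series a) = - exp_series a * Abs_fps (\<lambda>k. a (Suc k))"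
proof -
  let ?E = "Abs_fps (\<lambda>n. fps_const (1 / fact n)) :: 'a fps fps"
  let ?L = "Abs_fps (\<lambda>k. fps_const (1 / of_nat k) * a k)"
  have E: "fps_deriv ?E = ?E"
  proof (rule fps_ext)
    fix n
    have "(1 + of_nat n :: 'a) \<noteq> 0"
      by (metis of_nat_Suc of_nat_neq_0)
    then show "fps_nth (fps_deriv ?E) n = fps_nth ?E n"
      by (simp add: fps_of_nat[symmetric] del: of_nat_Suc fps_const_mult)
  qed
  have L: "fps_deriv ?L = Abs_fps (\<lambda>k. a (Suc k))"
  proof (rule fps_ext)
    fix n
    have "fps_const (of_nat (Suc n)) * (fps_const (1 / of_nat (Suc n)) * a (Suc n))
        = a (Suc n)"
      unfolding mult.assoc[symmetric] fps_const_mult by (simp del: of_nat_Suc)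
    then show "fps_nth (fps_deriv ?L) n = fps_nth (Abs_fps (\<lambda>k. a (Suc k))) n"
      by (simp add: fps_of_nat[symmetric] del: of_nat_Suc)
  qed
  show ?thesis
    unfolding exp_series_def by (subst fps_compose_deriv) (simp_all add: E L)
qed

lemma exp_series_eq_iff: "exp_series a = exp_series b \<longleftrightarrow> (\<forall>k>0. a k = b k)"
proof
  assume eq: "exp_series a = exp_series b"
  have "exp_series b \<noteq> 0"
    using exp_series_nth_0[of b] by auto
  moreover have "exp_series b * Abs_fps (\<lambda>k. a (Suc k)) = exp_series b * Abs_fps (\<lambda>k. b (Suc k))"
    using fps_deriv_exp_series[of a] fps_deriv_exp_series[of b] eq
    by (metis mult_minus_left neg_equal_iff_equal)
  ultimately have "Abs_fps (\<lambda>k. a (Suc k)) = Abs_fps (\<lambda>k. b (Suc k))"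
    by simp
  then have "a (Suc k) = b (Suc k)" for k
    by (metis fps_nth_Abs_fps)
  then show "\<forall>k>0. a k = b k"
    by (metis Suc_pred)
next
  assume "\<forall>k>0. a k = b k"
  then have "fps_const (1 / of_nat k) * a k = fps_const (1 / of_nat k) * b k" for k
    by (cases "k = 0") simp_all
  then show "exp_series a = exp_series b"
    unfolding exp_series_def by presburger
qed

lemma exp_series_exists:
  fixes A :: "'c::field_char_0 fps fps"
  assumes "fps_nth A 0 = 1"
  shows "\<exists>a. A = exp_series a"
proof -
  define B where "B = fps_right_inverse A 1"
  have AB: "A * B = 1"
    unfolding B_def by (rule fps_right_inverse) (simp add: assms)
  define D where "D = - (B * fps_deriv A)"
  define a where "a = (\<lambda>k. fps_nth D (k - 1))"
  define E where "E = exp_series a"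
  have dE: "fps_deriv E = - E * D"
    unfolding E_def fps_deriv_exp_series by (simp add: a_def fps_nth_inverse)
  have "A * fps_deriv B + fps_deriv A * B = 0"
    using arg_cong[OF AB, of fps_deriv] by simp
  then have "B * (A * fps_deriv B + fps_deriv A * B) = 0"
    by simp
  then have "(A * B) * fps_deriv B = D * B"
    by (simp add: D_def algebra_simps eq_neg_iff_add_eq_0)
  then have "fps_deriv (E * B) = 0"
    using dE by (simp add: AB algebra_simps)
  then have "E * B = fps_const (fps_nth (E * B) 0)"
    by (simp only: fps_deriv_eq_0_iff)
  moreover have "fps_nth (E * B) 0 = 1"
    using arg_cong[OF AB, of "\<lambda>f. fps_nth f 0"] assms
    by (simp add: E_def exp_series_nth_0)
  ultimately have "E * B = 1"
    by simp
  have "E = E * (A * B)"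
    by (simp add: AB)
  also have "\<dots> = A * (E * B)"
    by (simp add: mult_ac)
  finally have "E = A"
    by (simp add: \<open>E * B = 1\<close>)
  then show ?thesis
    unfolding E_def by blast
qed

lemma exp_coeffs_exp_series: "k > 0 \<Longrightarrow> exp_coeffs (exp_series a) k = a k"
proof -
  assume k: "k > 0"
  have "exp_coeffs (exp_series a) = a(0 := 0)"
    unfolding exp_coeffs_def
  proof (rule the_equality)
    show "(a(0 := 0)) 0 = 0 \<and> exp_series a = exp_series (a(0 := 0))"
      by (simp add: exp_series_eq_iff)
  next
    fix b
    assume "b 0 = 0 \<and> exp_series a = exp_series b"
    then show "b = a(0 := 0)"
      by (auto simp: exp_series_eq_iff)
  qed
  with k show ?thesis
    by simp
qed

lemma tensor_exp_series:
  "tensor (exp_series a) (exp_series b) = exp_series (\<lambda>k. a k * b k)"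
  by (simp add: tensor_def exp_series_eq_iff exp_coeffs_exp_series)

end

theory Submission
  imports Defs "HOL-Algebra.Finite_Extensions"
begin

text \<open>
  For \<open>t\<close> with \<open>0 < |t| < 1\<close> consider the Legendre transform \<open>M\<^sub>t(l) =
  min\<^sub>i (ord\<^sub>t a\<^sub>i(t) + l i)\<close> of the t-adic Newton polygon of A(s,t), and likewise
  the T-adic transform \<open>M\<^sub>T\<close>. A Newton polygon and its Legendre transform determine each
  other (\<open>newton_polygon_eq_if_legendre_min_eq\<close> and
  \<open>legendre_min_unique_if_newton_polygon_eq\<close>), so stability means \<open>M\<^sub>t =
  M\<^sub>T\<close> for all t. Moreover \<open>ord\<^sub>t a(t)\<close> tends to \<open>ord\<^sub>T a\<close>
  as t tends to 0. Therefore a series is T-adic entire and stable as soon as \<open>M\<^sub>t\<close> exists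
  and does not depend on t (\<open>stable_series_iff\<close>). This removes the T-adic side from the problem:
  no roots over the field of Laurent series in T are needed, and T-adic entireness of products and tensor
  products comes for free. It is convenient to write \<open>|t|^M\<^sub>t(l)\<close>, which is the Gauss norm
  of A(s,t) at radius \<open>|t|^l\<close>.

  For products, the Gauss norm is multiplicative (\<open>gauss_max_mult\<close>).

  For tensor products, suppose first that A(s,t) and B(s,t) are products of factors \<open>1 -
  \<alpha>\<^sub>i s\<close> and \<open>1 - \<beta>\<^sub>j s\<close>. Then \<open>M\<^sub>t(l)\<close> is
  \<open>\<Sum>i. min 0 (l + ord\<^sub>t \<alpha>\<^sub>i)\<close> for A, and its kinks recover the valuations
  of the \<open>\<alpha>\<^sub>i\<close> with multiplicities (\<open>card_slopes_eq\<close>). The reciprocal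
  roots of the tensor product are the \<open>\<alpha>\<^sub>i \<beta>\<^sub>j\<close>, so its transform
  \<open>\<Sum>i j. min 0 (l + ord\<^sub>t \<alpha>\<^sub>i + ord\<^sub>t \<beta>\<^sub>j)\<close> depends
  only on the transforms of A and B, which do not vary with t. In general, A(s,t) and B(s,t) are limits of
  split polynomials over the algebraic numbers, with unchanged Gauss norms up to a given radius
  (\<open>split_approximation\<close>). The coefficients of the tensor product are continuous functions of
  finitely many coefficients of the factors, and for a given l only the slopes below some bound matter, so the
  formula survives the limit (\<open>gauss_max_tensor\<close>).

  That the tensor product has coefficients in the same ring follows from its expression in Witt coordinates
  (\<open>tensor_integral\<close>).
\<close>

section \<open>The absolute value of a p-adic complex field\<close>

context padic_complex_field
begin

lemma absv_zero [simp]: "absv (0 :: 'c) = 0"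
  by (simp add: absv_def)

lemma absv_nonneg [simp]: "absv (x :: 'c) \<ge> 0"
  by (simp add: absv_def)

lemma absv_eq_0_iff [simp]: "absv (x :: 'c) = 0 \<longleftrightarrow> x = 0"
  by (simp add: absv_def)

lemma absv_pos_iff [simp]: "absv (x :: 'c) > 0 \<longleftrightarrow> x \<noteq> 0"
  by (simp add: absv_def)

lemma absv_one [simp]: "absv (1 :: 'c) = 1"
  using absv_mult[of 1 1] absv_eq_0_iff[of 1] by (metis mult.right_neutral mult_cancel_left zero_neq_one)

lemma absv_minus [simp]: "absv (- x :: 'c) = absv x"
  using dist_absv[of 0 x] by (simp add: absv_def dist_commute)

lemma absv_power: "absv (x ^ n :: 'c) = absv x ^ n"
  by (induction n) (auto simp: absv_mult)

lemma absv_inverse: "absv (inverse x :: 'c) = inverse (absv x)"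
proof (cases "x = 0")
  case False
  then have "absv x * absv (inverse x) = 1"
    by (simp flip: absv_mult)
  then show ?thesis
    using False by (metis absv_eq_0_iff inverse_unique)
qed auto

lemma absv_minus_commute: "absv (x - y :: 'c) = absv (y - x)"
  by (metis absv_minus minus_diff_eq)

lemma absv_diff: "absv (x - y :: 'c) \<le> max (absv x) (absv y)"
  using absv_ultrametric[of x "- y"] by simp

lemma absv_add_eq: "absv y < absv x \<Longrightarrow> absv (x + y :: 'c) = absv x"
  using absv_ultrametric[of x y] absv_diff[of "x + y" y] by auto

text \<open>
  The isosceles triangle principle.
\<close>

lemma absv_eqI: "absv (x - y) < absv x \<Longrightarrow> absv (y :: 'c) = absv x"
  using absv_add_eq[of "y - x" x] by (simp add: absv_minus_commute)

lemma absv_sum_le: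
  assumes "\<And>i. i \<in> S \<Longrightarrow> absv (f i :: 'c) \<le> c" and "c \<ge> 0"
  shows "absv (sum f S) \<le> c"
  using assms
proof (induction S rule: infinite_finite_induct)
  case (insert x F)
  then show ?case
    using absv_ultrametric[of "f x" "sum f F"] by fastforce
qed auto

lemma absv_sum_less:
  assumes "\<And>i. i \<in> S \<Longrightarrow> absv (f i :: 'c) < c" and "c > 0"
  shows "absv (sum f S) < c"
  using assms
proof (induction S rule: infinite_finite_induct)
  case (insert x F)
  then show ?case
    using absv_ultrametric[of "f x" "sum f F"] by fastforce
qed auto

text \<open>
  The type carries no topological ring structure of its own: continuity of the field operations follows from
  the ultrametric inequality through this criterion.
\<close>

lemma tendsto_iff_absv: "(f \<longlongrightarrow> (l :: 'c)) F \<longleftrightarrow> ((\<lambda>x. absv (f x - l)) \<longlongrightarrow> 0) F"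
  by (subst tendsto_dist_iff) (simp add: dist_absv)

lemma tendsto_add_padic:
  assumes "(f \<longlongrightarrow> (l :: 'c)) F" and "(g \<longlongrightarrow> m) F"
  shows "((\<lambda>x. f x + g x) \<longlongrightarrow> l + m) F"
proof -
  have "((\<lambda>x. max (absv (f x - l)) (absv (g x - m))) \<longlongrightarrow> max 0 0) F"
    using assms by (intro tendsto_max) (auto simp: tendsto_iff_absv)
  then have h: "((\<lambda>x. max (absv (f x - l)) (absv (g x - m))) \<longlongrightarrow> 0) F"
    by simp
  have "absv (f x + g x - (l + m)) \<le> max (absv (f x - l)) (absv (g x - m))" for x
    using absv_ultrametric[of "f x - l" "g x - m"] by (simp add: algebra_simps)
  then have "((\<lambda>x. absv (f x + g x - (l + m))) \<longlongrightarrow> 0) F"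
    by (intro tendsto_sandwich[OF _ _ tendsto_const h] always_eventually allI absv_nonneg)
  then show ?thesis
    by (rule tendsto_iff_absv[THEN iffD2])
qed

lemma tendsto_absv:
  assumes "(f \<longlongrightarrow> (l :: 'c)) F"
  shows "((\<lambda>x. absv (f x)) \<longlongrightarrow> absv l) F"
  unfolding absv_def by (intro tendsto_dist assms tendsto_const)

lemma tendsto_mult_padic:
  assumes "(f \<longlongrightarrow> (l :: 'c)) F" and "(g \<longlongrightarrow> m) F"
  shows "((\<lambda>x. f x * g x) \<longlongrightarrow> l * m) F"
proof -
  let ?h = "\<lambda>x. max (absv (f x) * absv (g x - m)) (absv m * absv (f x - l))"
  have "(?h \<longlongrightarrow> max (absv l * 0) (absv m * 0)) F"
    using assms by (intro tendsto_max tendsto_mult tendsto_absv tendsto_const)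
      (auto simp: tendsto_iff_absv)
  then have h: "(?h \<longlongrightarrow> 0) F"
    by simp
  have "absv (f x * g x - l * m) \<le> ?h x" for x
  proof -
    have "f x * g x - l * m = f x * (g x - m) + m * (f x - l)"
      by (simp add: algebra_simps)
    then show ?thesis
      using absv_ultrametric[of "f x * (g x - m)" "m * (f x - l)"] by (simp add: absv_mult)
  qed
  then have "((\<lambda>x. absv (f x * g x - l * m)) \<longlongrightarrow> 0) F"
    by (intro tendsto_sandwich[OF _ _ tendsto_const h] always_eventually allI absv_nonneg)
  then show ?thesis
    by (rule tendsto_iff_absv[THEN iffD2])
qed

lemma tendsto_sum_padic:
  assumes "\<And>i. i \<in> S \<Longrightarrow> ((\<lambda>x. f x i) \<longlongrightarrow> (l i :: 'c)) F"
  shows "((\<lambda>x. \<Sum>i\<in>S. f x i) \<longlongrightarrow> (\<Sum>i\<in>S. l i)) F"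
  using assms
  by (induction S rule: infinite_finite_induct) (auto intro!: tendsto_add_padic)

lemma tendsto_minus_padic:
  "(f \<longlongrightarrow> (l :: 'c)) F \<Longrightarrow> ((\<lambda>x. - f x) \<longlongrightarrow> - l) F"
  using tendsto_mult_padic[of "\<lambda>_. -1" "-1" F f l] by simp

lemma tendsto_inverse_padic:
  assumes "(f \<longlongrightarrow> (l :: 'c)) F" and "l \<noteq> 0"
  shows "((\<lambda>x. inverse (f x)) \<longlongrightarrow> inverse l) F"
proof -
  have lim: "((\<lambda>x. absv (f x - l) / (absv (f x) * absv l)) \<longlongrightarrow> 0 / (absv l * absv l)) F"
    using assms by (intro tendsto_intros tendsto_absv) (auto simp: tendsto_iff_absv)
  have "\<forall>\<^sub>F x in F. absv (f x) > 0"
    using order_tendstoD(1)[OF tendsto_absv[OF assms(1)], of 0] assms(2) by simp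
  then have ev: "\<forall>\<^sub>F x in F. absv (f x - l) / (absv (f x) * absv l) = absv (inverse (f x) - inverse l)"
  proof eventually_elim
    case (elim x)
    then have "inverse (f x) - inverse l = (l - f x) * inverse (f x) * inverse l"
      using assms(2) by (simp add: field_simps)
    then show ?case
      by (simp add: absv_mult absv_inverse divide_inverse absv_minus_commute)
  qed
  have "((\<lambda>x. absv (inverse (f x) - inverse l)) \<longlongrightarrow> 0) F"
    using lim tendsto_cong[OF ev, of 0] by simp
  then show ?thesis
    by (rule tendsto_iff_absv[THEN iffD2])
qed

lemma rational_limit_iff: "(x :: 'c) \<in> closure \<rat> \<longleftrightarrow> (\<exists>f. (\<forall>n. f n \<in> \<rat>) \<and> f \<longlonglongrightarrow> x)"
  by (simp add: closure_sequential)

lemma padic_rationals_minus: "(x :: 'c) \<in> closure \<rat> \<Longrightarrow> - x \<in> closure \<rat>"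
  unfolding rational_limit_iff by (metis Rats_minus_iff tendsto_minus_padic)

lemma padic_rationals_inverse: "(x :: 'c) \<in> closure \<rat> \<Longrightarrow> inverse x \<in> closure \<rat>"
proof (cases "x = 0")
  case False
  moreover assume "x \<in> closure \<rat>"
  ultimately show ?thesis
    unfolding rational_limit_iff by (metis Rats_inverse tendsto_inverse_padic)
qed simp

lemma padic_rationals_add:
  assumes "(x :: 'c) \<in> closure \<rat>" and "y \<in> closure \<rat>"
  shows "x + y \<in> closure \<rat>"
proof -
  obtain f g where "\<forall>n. f n \<in> \<rat>" "f \<longlonglongrightarrow> x" "\<forall>n. g n \<in> \<rat>" "g \<longlonglongrightarrow> y"
    using assms unfolding rational_limit_iff by blast
  then show ?thesis
    unfolding rational_limit_iff
    by (intro exI[of _ "\<lambda>n. f n + g n"]) (auto intro: tendsto_add_padic)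
qed

lemma padic_rationals_mult:
  assumes "(x :: 'c) \<in> closure \<rat>" and "y \<in> closure \<rat>"
  shows "x * y \<in> closure \<rat>"
proof -
  obtain f g where "\<forall>n. f n \<in> \<rat>" "f \<longlonglongrightarrow> x" "\<forall>n. g n \<in> \<rat>" "g \<longlonglongrightarrow> y"
    using assms unfolding rational_limit_iff by blast
  then show ?thesis
    unfolding rational_limit_iff
    by (intro exI[of _ "\<lambda>n. f n * g n"]) (auto intro: tendsto_mult_padic)
qed
end

section \<open>Algebraic numbers over the p-adic rationals\<close>

lemma field_subring_of_UNIV: "field (subring_of (UNIV :: 'a::Fields.field set))"
proof -
  have "\<exists>y. x + y = 0" for x :: 'a
    using add.right_inverse by blast
  moreover have "x \<noteq> 0 \<Longrightarrow> \<exists>y. x * y = 1" for x :: 'a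
    by (rule exI[of _ "inverse x"]) auto
  ultimately show ?thesis
    unfolding subring_of_def using add.right_inverse
    by unfold_locales (auto simp: algebra_simps Units_def)
qed

text \<open>
  The algebra of polynomials as coefficient lists, highest coefficient first, meets the type of polynomials
  here.
\<close>

lemma eval_subring_of_UNIV:
  "ring.eval (subring_of (UNIV :: 'a::Fields.field set)) (map (Polynomial.coeff f) (rev [0..<n])) x
    = (\<Sum>i<n. Polynomial.coeff f i * x ^ i)"
proof -
  interpret K: field "subring_of (UNIV :: 'a set)"
    by (rule field_subring_of_UNIV)
  have pow: "x [^]\<^bsub>subring_of (UNIV :: 'a set)\<^esub> (k::nat) = x ^ k" for k
    by (induction k) (auto simp: subring_of_def nat_pow_def mult.commute)
  show ?thesis
    by (induction n) (auto simp: pow, auto simp: subring_of_def add.commute)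
qed

text \<open>
  This makes the theorem that the algebraic elements over a subfield form a subfield available for the set
  \<open>algebraic_over F\<close>.
\<close>

lemma algebraic_over_eq:
  fixes F :: "'a::Fields.field set"
  assumes "subring F (subring_of UNIV)"
  shows "algebraic_over F
    = {x \<in> carrier (subring_of UNIV). (ring.algebraic (subring_of UNIV) over F) x}"
proof -
  interpret K: field "subring_of (UNIV :: 'a set)"
    by (rule field_subring_of_UNIV)
  have zero: "\<zero>\<^bsub>subring_of (UNIV :: 'a set)\<^esub> = 0" and carrier: "carrier (subring_of (UNIV :: 'a set)) = UNIV"
    by (simp_all add: subring_of_def)
  have "x \<in> {x \<in> carrier (subring_of UNIV). (K.algebraic over F) x}"
    if "x \<in> algebraic_over F" for x :: 'a
  proof -
    from that obtain f where f: "f \<noteq> 0" "\<And>i. Polynomial.coeff f i \<in> F" "poly f x = 0"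
      by (auto simp: algebraic_over_def)
    let ?l = "map (Polynomial.coeff f) (rev [0..<Suc (Polynomial.degree f)])"
    have "polynomial\<^bsub>subring_of UNIV\<^esub> F ?l"
      using f by (auto simp: polynomial_def zero)
    moreover have "K.eval ?l x = \<zero>\<^bsub>subring_of (UNIV :: 'a set)\<^esub>"
      using f(3) unfolding eval_subring_of_UNIV zero
      by (simp add: poly_altdef lessThan_Suc_atMost)
    ultimately show ?thesis
      using K.algebraicI[of ?l F x] by (simp add: univ_poly_def carrier)
  qed
  moreover have "x \<in> algebraic_over F"
    if "x \<in> {x \<in> carrier (subring_of UNIV). (K.algebraic over F) x}" for x :: 'a
  proof -
    from that obtain l where l: "polynomial\<^bsub>subring_of UNIV\<^esub> F l" "l \<noteq> []" "K.eval l x = 0"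
      using K.algebraicE[OF assms, of x] by (auto simp: univ_poly_def zero)
    define f where "f = Poly (rev l)"
    have nth: "Polynomial.coeff f i = (if i < length l then l ! (length l - Suc i) else 0)" for i
      by (simp add: f_def nth_default_def rev_nth)
    have "map (Polynomial.coeff f) (rev [0..<length l]) = l"
      by (intro nth_equalityI) (auto simp: nth rev_nth)
    then have "(\<Sum>i<length l. Polynomial.coeff f i * x ^ i) = 0"
      using l(3) eval_subring_of_UNIV[of f "length l" x] by simp
    moreover have "Polynomial.degree f < length l"
      using l(2) nth by (metis coeff_0 degree_0 leading_coeff_neq_0 length_greater_0_conv)
    then have "poly f x = (\<Sum>i<length l. Polynomial.coeff f i * x ^ i)"
      by (auto simp: poly_altdef intro!: sum.mono_neutral_left coeff_eq_0)
    moreover have "Polynomial.coeff f i \<in> F" for i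
      using l(1) subringE(2)[OF assms] by (auto simp: nth polynomial_def zero)
    moreover have "Polynomial.coeff f (length l - 1) \<noteq> 0"
      using l(1,2) by (cases l) (auto simp: nth polynomial_def zero)
    then have "f \<noteq> 0"
      by auto
    ultimately show ?thesis
      by (auto simp: algebraic_over_def)
  qed
  ultimately show ?thesis
    by blast
qed

context padic_complex_field
begin

lemma subfield_padic_rationals: "subfield (closure \<rat>) (subring_of (UNIV :: 'c set))"
proof -
  interpret K: field "subring_of (UNIV :: 'c set)"
    by (rule field_subring_of_UNIV)
  have minus: "\<ominus>\<^bsub>subring_of UNIV\<^esub> x = - x" for x :: 'c
    by (rule K.minus_equality) (auto simp: subring_of_def)
  have inverse: "inv\<^bsub>subring_of UNIV\<^esub> x = inverse x" if "x \<noteq> 0" for x :: 'c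
    by (rule K.inv_unique'[symmetric]) (use that in \<open>auto simp: subring_of_def\<close>)
  have one: "1 \<in> closure (\<rat> :: 'c set)"
    by (simp add: subsetD[OF closure_subset])
  show ?thesis
  proof (intro K.subfieldI' K.subringI)
    fix k assume k: "k \<in> closure \<rat> - {\<zero>\<^bsub>subring_of (UNIV :: 'c set)\<^esub>}"
    then have "k \<noteq> 0"
      by (simp add: subring_of_def)
    then show "inv\<^bsub>subring_of UNIV\<^esub> k \<in> closure \<rat>"
      using k by (simp add: inverse padic_rationals_inverse)
  qed (use padic_rationals_add padic_rationals_mult padic_rationals_minus one minus in
      \<open>auto simp: subring_of_def\<close>)
qed

abbreviation padic_algebraic :: "'c set" where
  "padic_algebraic \<equiv> algebraic_over (closure \<rat>)"

lemma padic_algebraic_closed: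
  shows "1 \<in> padic_algebraic" and "0 \<in> padic_algebraic"
    and "x \<in> padic_algebraic \<Longrightarrow> - x \<in> padic_algebraic"
    and "x \<in> padic_algebraic \<Longrightarrow> y \<in> padic_algebraic \<Longrightarrow> x + y \<in> padic_algebraic"
    and "x \<in> padic_algebraic \<Longrightarrow> y \<in> padic_algebraic \<Longrightarrow> x * y \<in> padic_algebraic"
proof -
  interpret K: field "subring_of (UNIV :: 'c set)"
    by (rule field_subring_of_UNIV)
  have minus: "\<ominus>\<^bsub>subring_of UNIV\<^esub> x = - x" for x :: 'c
    by (rule K.minus_equality) (auto simp: subring_of_def)
  have "subfield padic_algebraic (subring_of (UNIV :: 'c set))"
    using K.subfield_of_algebraics[OF subfield_padic_rationals]
      algebraic_over_eq[OF subfieldE(1)[OF subfield_padic_rationals]] by simp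
  note L = subringE[OF subfieldE(1)[OF this]]
  show "1 \<in> padic_algebraic" and "0 \<in> padic_algebraic"
    using L(2,3) by (simp_all add: subring_of_def)
  show "x \<in> padic_algebraic \<Longrightarrow> - x \<in> padic_algebraic"
    using L(5)[of x] by (simp add: minus)
  show "x \<in> padic_algebraic \<Longrightarrow> y \<in> padic_algebraic \<Longrightarrow> x + y \<in> padic_algebraic"
    using L(7)[of x y] by (simp add: subring_of_def)
  show "x \<in> padic_algebraic \<Longrightarrow> y \<in> padic_algebraic \<Longrightarrow> x * y \<in> padic_algebraic"
    using L(6)[of x y] by (simp add: subring_of_def)
qed

text \<open>
  Being algebraically closed provides one root at a time. Dividing by the linear factor of a root r keeps the
  coefficients algebraic: they solve \<open>g\<^sub>i = f\<^sub>i\<^sub>+\<^sub>1 + r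
  g\<^sub>i\<^sub>+\<^sub>1\<close> from the top degree downwards. Since the constant term is 1, all roots are
  nonzero and the factors can be normalised to \<open>1 - \<alpha> s\<close>.
\<close>

lemma padic_algebraic_split:
  assumes "\<And>i. Polynomial.coeff f i \<in> padic_algebraic" and "Polynomial.coeff f 0 = 1"
  shows "\<exists>\<alpha>. (\<forall>i. \<alpha> i \<noteq> 0) \<and> f = (\<Prod>i<Polynomial.degree f. [:1, - \<alpha> i:])"
  using assms
proof (induction "Polynomial.degree f" arbitrary: f)
  case 0
  then have "f = 1"
    by (metis degree_eq_zeroE one_pCons coeff_pCons_0)
  then show ?case
    by (auto intro!: exI[of _ "\<lambda>_. 1"])
next
  case (Suc n)
  then obtain r where r: "r \<in> padic_algebraic" "poly f r = 0"
    using algebraically_closed[of f] by auto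
  with Suc.prems(2) have "r \<noteq> 0"
    by (auto simp: poly_0_coeff_0)
  obtain g where g: "f = [:- r, 1:] * g"
    using r(2) by (auto simp: poly_eq_0_iff_dvd)
  define h where "h = Polynomial.smult (- r) g"
  have f: "f = [:1, - inverse r:] * h"
    unfolding g h_def using \<open>r \<noteq> 0\<close> by (simp add: field_simps smult_diff_right)
  have "f \<noteq> 0"
    using Suc.prems(2) by auto
  then have g0: "g \<noteq> 0"
    using g by auto
  have "Polynomial.degree f = Suc (Polynomial.degree g)"
    unfolding g using g0 by (subst degree_mult_eq) auto
  then have deg: "Polynomial.degree h = n"
    using Suc.hyps(2) \<open>r \<noteq> 0\<close> by (simp add: h_def)
  have coeff_g: "Polynomial.coeff g i = Polynomial.coeff f (Suc i) + r * Polynomial.coeff g (Suc i)" for i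
    by (simp add: g)
  have alg: "Polynomial.coeff g i \<in> padic_algebraic" if "i \<le> Suc n" for i
    using that
  proof (induction rule: inc_induct)
    case base
    have "Polynomial.coeff g (Suc n) = 0"
      using deg \<open>r \<noteq> 0\<close> by (intro coeff_eq_0) (simp add: h_def)
    then show ?case
      by (simp add: padic_algebraic_closed)
  next
    case (step i)
    then show ?case
      using coeff_g[of i] by (simp add: padic_algebraic_closed r Suc.prems)
  qed
  have "Polynomial.coeff h i \<in> padic_algebraic" for i
  proof (cases "i \<le> Suc n")
    case True
    then show ?thesis
      using alg r(1) padic_algebraic_closed(3,5) by (simp add: h_def)
  next
    case False
    then show ?thesis
      using deg by (simp add: coeff_eq_0 padic_algebraic_closed)
  qed
  moreover have "Polynomial.coeff h 0 = 1"
    using Suc.prems(2) by (simp add: f)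
  ultimately obtain \<alpha> where \<alpha>: "\<And>i. \<alpha> i \<noteq> 0" "h = (\<Prod>i<n. [:1, - \<alpha> i:])"
    using Suc.hyps(1)[of h] deg by auto
  have "f = (\<Prod>i<Suc n. [:1, - (\<alpha>(n := inverse r)) i:])"
    by (simp add: f \<alpha>(2) mult.commute)
  then show ?case
    using \<alpha>(1) \<open>r \<noteq> 0\<close> Suc.hyps(2)
    by (intro exI[of _ "\<alpha>(n := inverse r)"]) auto
qed

text \<open>
  Besides being close, the approximation keeps the absolute value exactly (the isosceles triangle principle)
  and keeps the number 1, so that Gauss norms and constant terms survive the replacement of coefficients.
\<close>

lemma padic_algebraic_approx:
  assumes "e > 0"
  shows "\<exists>y \<in> padic_algebraic. absv (y - x) < e \<and> absv y = absv (x :: 'c) \<and> (x = 1 \<longrightarrow> y = 1)"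
proof (cases "x = 0 \<or> x = 1")
  case True
  then show ?thesis
    using padic_algebraic_closed(1,2) assms by (intro bexI[of _ x]) auto
next
  case False
  have "x \<in> closure padic_algebraic"
    by (simp add: algebraic_dense)
  then obtain y where y: "y \<in> padic_algebraic" "absv (y - x) < min e (absv x)"
    using False assms unfolding closure_approachable dist_absv
    by (metis absv_pos_iff min_less_iff_conj)
  then show ?thesis
    using False absv_eqI[of x y] by (auto simp: absv_minus_commute)
qed

end

section \<open>Power sums of the reciprocal roots\<close>

text \<open>
  The relation \<open>A = exp (- \<Sum>k\<ge>1. a k * s ^ k / k)\<close> in a form without division, through
  the logarithmic derivative, so that it makes sense over every commutative ring. If \<open>A = \<Prod>i. 1 -
  \<alpha>\<^sub>i s\<close>, then \<open>a k\<close> is the power sum \<open>\<Sum>i. \<alpha>\<^sub>i ^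
  k\<close>; hence the name. The sequence starts at index 1.
\<close>

definition power_sums :: "'r::comm_ring_1 fps \<Rightarrow> (nat \<Rightarrow> 'r) \<Rightarrow> bool" where
  "power_sums A a \<longleftrightarrow> fps_nth A 0 = 1 \<and> fps_deriv A = - A * Abs_fps (\<lambda>k. a (Suc k))"

lemma power_sums_exp_series: "power_sums (exp_series a) a"
  by (simp add: power_sums_def exp_series_nth_0 fps_deriv_exp_series)

lemma power_sums_cong:
  "power_sums A a \<Longrightarrow> (\<And>k. a (Suc k) = b (Suc k)) \<Longrightarrow> power_sums A b"
  by (simp add: power_sums_def)

lemma newton_identity:
  assumes "power_sums A a"
  shows "of_nat (Suc n) * fps_nth A (Suc n) + (\<Sum>i\<le>n. fps_nth A i * a (Suc (n - i))) = 0"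
proof -
  have "fps_nth (fps_deriv A) n = fps_nth (- A * Abs_fps (\<lambda>k. a (Suc k))) n"
    using assms by (simp only: power_sums_def)
  then show ?thesis
    by (simp add: fps_mult_nth atLeast0AtMost sum_negf del: of_nat_Suc)
qed

lemma power_sumsI:
  assumes "fps_nth A 0 = 1"
    and "\<And>n. of_nat (Suc n) * fps_nth A (Suc n) + (\<Sum>i\<le>n. fps_nth A i * a (Suc (n - i))) = 0"
  shows "power_sums A a"
  unfolding power_sums_def
proof (intro conjI fps_ext)
  show "fps_nth (fps_deriv A) n = fps_nth (- A * Abs_fps (\<lambda>k. a (Suc k))) n" for n
    using assms(2)[of n]
    by (simp add: fps_mult_nth atLeast0AtMost sum_negf eq_neg_iff_add_eq_0 del: of_nat_Suc)
qed fact

text \<open>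
  Newton's identities solved for the highest power sum: no division occurs, so power sums are integral
  polynomials in the coefficients.
\<close>

lemma power_sums_Suc:
  assumes "power_sums A a"
  shows "a (Suc n) = - (of_nat (Suc n) * fps_nth A (Suc n))
    - (\<Sum>i<n. fps_nth A (Suc i) * a (n - i))"
proof -
  have "(\<Sum>i\<le>n. fps_nth A i * a (Suc (n - i))) = a (Suc n) + (\<Sum>i<n. fps_nth A (Suc i) * a (Suc (n - Suc i)))"
    using assms by (simp only: lessThan_Suc_atMost[symmetric] sum.lessThan_Suc_shift) (simp add: power_sums_def)
  also have "(\<Sum>i<n. fps_nth A (Suc i) * a (Suc (n - Suc i))) = (\<Sum>i<n. fps_nth A (Suc i) * a (n - i))"
    by (intro sum.cong) (auto simp: Suc_diff_Suc)
  finally show ?thesis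
    using newton_identity[OF assms, of n] by (simp add: algebra_simps eq_neg_iff_add_eq_0 del: of_nat_Suc)
qed

lemma power_sums_eq_if_coeffs_eq:
  assumes "power_sums A a" and "power_sums B b" and "\<And>i. i \<le> n \<Longrightarrow> fps_nth A i = fps_nth B i"
  shows "0 < k \<Longrightarrow> k \<le> n \<Longrightarrow> a k = b k"
proof (induction k rule: less_induct)
  case (less k)
  then obtain m where m: "k = Suc m"
    by (cases k) auto
  have "(\<Sum>i<m. fps_nth A (Suc i) * a (m - i)) = (\<Sum>i<m. fps_nth B (Suc i) * b (m - i))"
    using less m assms(3) by (intro sum.cong) auto
  then show ?case
    using power_sums_Suc[OF assms(1), of m] power_sums_Suc[OF assms(2), of m] less.prems assms(3)
    by (simp add: m)
qed

text \<open>
  Newton's identities solved for the highest coefficient, which requires dividing by a positive integer.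
\<close>

lemma coeffs_eq_if_power_sums_eq:
  fixes A B :: "'r::{idom, semiring_char_0} fps"
  assumes "power_sums A a" and "power_sums B b" and "\<And>k. 0 < k \<Longrightarrow> k \<le> n \<Longrightarrow> a k = b k"
  shows "i \<le> n \<Longrightarrow> fps_nth A i = fps_nth B i"
proof (induction i rule: less_induct)
  case (less i)
  show ?case
  proof (cases i)
    case 0
    then show ?thesis
      using assms by (simp add: power_sums_def)
  next
    case (Suc m)
    have "(\<Sum>j\<le>m. fps_nth A j * a (Suc (m - j))) = (\<Sum>j\<le>m. fps_nth B j * b (Suc (m - j)))"
      using less Suc assms(3) by (intro sum.cong) auto
    then have "of_nat (Suc m) * fps_nth A (Suc m) = of_nat (Suc m) * fps_nth B (Suc m)"
      using newton_identity[OF assms(1), of m] newton_identity[OF assms(2), of m]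
      by (metis add_right_imp_eq)
    then show ?thesis
      using Suc by (simp del: of_nat_Suc)
  qed
qed

lemma power_sums_one: "power_sums 1 (\<lambda>_. 0)"
  by (simp add: power_sums_def fps_zero_def[symmetric])

lemma power_sums_mult:
  assumes "power_sums A a" and "power_sums B b"
  shows "power_sums (A * B) (\<lambda>k. a k + b k)"
proof -
  have "Abs_fps (\<lambda>k. a (Suc k) + b (Suc k)) = Abs_fps (\<lambda>k. a (Suc k)) + Abs_fps (\<lambda>k. b (Suc k))"
    by (simp add: fps_plus_def)
  then show ?thesis
    using assms by (simp add: power_sums_def algebra_simps)
qed

lemma power_sums_prod:
  assumes "\<And>i. i \<in> I \<Longrightarrow> power_sums (A i) (a i)"
  shows "power_sums (\<Prod>i\<in>I. A i) (\<lambda>k. \<Sum>i\<in>I. a i k)"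
  using assms
  by (induction I rule: infinite_finite_induct) (auto intro: power_sums_one power_sums_mult)

lemma power_sums_binomial:
  assumes "k > 0"
  shows "power_sums (1 - fps_const c * fps_X ^ k)
    (\<lambda>j. if k dvd j then of_nat k * c ^ (j div k) else 0)" (is "power_sums ?A ?a")
proof -
  let ?G = "Abs_fps (\<lambda>j. ?a (Suc j))"
  have "fps_nth (fps_deriv ?A) n = fps_nth (- ?A * ?G) n" for n
  proof -
    have "fps_nth (- ?A * ?G) n = - fps_nth ?G n + c * fps_nth (fps_X ^ k * ?G) n"
      by (simp add: algebra_simps mult.assoc)
    also have "\<dots> = (if Suc n = k then - of_nat k * c else 0)"
    proof (cases "Suc n \<le> k")
      case True
      then have "k dvd Suc n \<longleftrightarrow> Suc n = k"
        by (auto dest: dvd_imp_le)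
      then show ?thesis
        using True assms by (auto simp: fps_X_power_mult_nth)
    next
      case False
      then obtain m where n: "Suc n = k + Suc m"
        by (metis less_iff_Suc_add not_le add_Suc_right)
      then have m: "n = k + m"
        by simp
      have "k dvd Suc n \<longleftrightarrow> k dvd Suc m" and "Suc n div k = Suc (Suc m div k)"
        using assms unfolding n by (simp_all del: add_Suc_right)
      then show ?thesis
        using assms by (simp add: fps_X_power_mult_nth m)
    qed
    also have "\<dots> = fps_nth (fps_deriv ?A) n"
      using assms by (auto simp: fps_X_power_nth simp del: of_nat_Suc)
    finally show ?thesis ..
  qed
  then show ?thesis
    using assms by (simp add: power_sums_def fps_eq_iff fps_X_power_nth)
qed

lemma power_sums_linear: "power_sums (1 - fps_const c * fps_X) (\<lambda>k. c ^ k)"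
  using power_sums_binomial[of 1 c] by simp

text \<open>
  The reciprocal roots of a tensor product are the products of the reciprocal roots.
\<close>

lemma power_sums_tensor_linear:
  "power_sums (\<Prod>i\<in>I. \<Prod>j\<in>J. 1 - fps_const (\<alpha> i * \<beta> j) * fps_X)
    (\<lambda>k. (\<Sum>i\<in>I. \<alpha> i ^ k) * (\<Sum>j\<in>J. \<beta> j ^ k))"
proof -
  have "power_sums (\<Prod>i\<in>I. \<Prod>j\<in>J. 1 - fps_const (\<alpha> i * \<beta> j) * fps_X)
      (\<lambda>k. \<Sum>i\<in>I. \<Sum>j\<in>J. (\<alpha> i * \<beta> j) ^ k)"
    by (intro power_sums_prod power_sums_linear)
  then show ?thesis
    by (simp add: sum_product power_mult_distrib)
qed

text \<open>
  The tensor product of \<open>1 - x s\<^sup>k\<close> and \<open>1 - y s\<^sup>m\<close>. Both power sums are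
  supported on multiples, so their product is supported on the multiples of the least common multiple, and
  \<open>k m = gcd k m * lcm k m\<close> turns the factor \<open>k m\<close> into the exponent \<open>gcd k
  m\<close>. What matters is that the result is integral.
\<close>

lemma power_sums_tensor_binomials:
  assumes "k > 0" and "m > 0"
  shows "power_sums ((1 - fps_const (x ^ (lcm k m div k) * y ^ (lcm k m div m)) * fps_X ^ lcm k m) ^ gcd k m)
    (\<lambda>j. (if k dvd j then of_nat k * x ^ (j div k) else 0) *
         (if m dvd j then of_nat m * y ^ (j div m) else 0))"
proof -
  \<comment> \<open>\<open>z\<close> is the product of the powers of x and y whose binomial has the required power sums.\<close>
  define L z where "L = lcm k m" and "z = x ^ (L div k) * y ^ (L div m)"
  have "L > 0"
    using assms by (simp add: L_def lcm_pos_nat)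
  have "power_sums (\<Prod>i<gcd k m. 1 - fps_const z * fps_X ^ L)
      (\<lambda>j. \<Sum>i<gcd k m. if L dvd j then of_nat L * z ^ (j div L) else 0)"
    by (intro power_sums_prod power_sums_binomial \<open>L > 0\<close>)
  moreover have "(\<Sum>i<gcd k m. if L dvd j then of_nat L * z ^ (j div L) else 0)
      = (if k dvd j then of_nat k * x ^ (j div k) else 0) *
        (if m dvd j then of_nat m * y ^ (j div m) else 0)" for j
  proof (cases "L dvd j")
    case True
    then have "k dvd j" and "m dvd j"
      by (auto simp: L_def)
    have div: "j div l = (L div l) * (j div L)" if "l dvd L" for l
      using dvd_div_mult[OF that, of "j div L"] True by (simp add: mult.commute)
    have "k dvd L" and "m dvd L"
      by (simp_all add: L_def)
    have "(of_nat (gcd k m) * of_nat L :: 'a) = of_nat k * of_nat m"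
      unfolding L_def by (metis of_nat_mult prod_gcd_lcm_nat)
    then have "of_nat (gcd k m) * (of_nat L * z ^ (j div L))
        = (of_nat k * of_nat m) * z ^ (j div L)"
      by (simp only: mult.assoc[symmetric])
    also have "\<dots> = (of_nat k * x ^ (j div k)) * (of_nat m * y ^ (j div m))"
      unfolding div[OF \<open>k dvd L\<close>] div[OF \<open>m dvd L\<close>] z_def power_mult power_mult_distrib
      by (simp only: mult_ac)
    finally show ?thesis
      using True \<open>k dvd j\<close> \<open>m dvd j\<close> by simp
  next
    case False
    then have "\<not> (k dvd j \<and> m dvd j)"
      by (simp add: L_def)
    then show ?thesis
      using False by auto
  qed
  ultimately show ?thesis
    by (simp add: L_def z_def)
qed

section \<open>Integrality of the tensor operation\<close>

locale coefficient_subring =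
  fixes S :: "'r::comm_ring_1 set"
  assumes zero: "0 \<in> S" and one: "1 \<in> S"
    and minus: "x \<in> S \<Longrightarrow> - x \<in> S"
    and add: "x \<in> S \<Longrightarrow> y \<in> S \<Longrightarrow> x + y \<in> S"
    and mult: "x \<in> S \<Longrightarrow> y \<in> S \<Longrightarrow> x * y \<in> S"
begin

lemma diff: "x \<in> S \<Longrightarrow> y \<in> S \<Longrightarrow> x - y \<in> S"
  using add[of x "- y"] minus[of y] by simp

lemma sum: "(\<And>i. i \<in> I \<Longrightarrow> f i \<in> S) \<Longrightarrow> sum f I \<in> S"
  by (induction I rule: infinite_finite_induct) (auto intro: zero add)

lemma prod: "(\<And>i. i \<in> I \<Longrightarrow> f i \<in> S) \<Longrightarrow> prod f I \<in> S"
  by (induction I rule: infinite_finite_induct) (auto intro: one mult)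

lemma power: "x \<in> S \<Longrightarrow> x ^ n \<in> S"
  by (induction n) (auto intro: one mult)

lemma of_nat: "of_nat n \<in> S"
  by (induction n) (auto intro: zero one add)

end

lemma Witt_coefficient_subring:
  assumes "is_Witt_subring p q R"
  shows "coefficient_subring R"
proof -
  interpret K: cring "subring_of R"
    using assms by (simp add: is_Witt_subring_def)
  have carrier: "carrier (subring_of R) = R"
    by (simp add: subring_of_def)
  show ?thesis
  proof
    fix x y assume xy: "x \<in> R" "y \<in> R"
    show "x + y \<in> R" "x * y \<in> R"
      using K.a_closed[of x y] K.m_closed[of x y] xy by (simp_all add: subring_of_def)
  next
    fix x assume "x \<in> R"
    then have "\<ominus>\<^bsub>subring_of R\<^esub> x \<in> R" "x + (\<ominus>\<^bsub>subring_of R\<^esub> x) = 0"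
      using K.a_inv_closed[of x] K.r_neg[of x] by (simp_all add: carrier) (simp add: subring_of_def)
    then show "- x \<in> R"
      by (metis add_eq_0_iff minus_minus)
  qed (use K.zero_closed K.one_closed in \<open>simp_all add: subring_of_def\<close>)
qed

definition fps_over :: "'r::zero set \<Rightarrow> 'r fps set" where
  "fps_over S = {A. \<forall>i. fps_nth A i \<in> S}"

lemma coefficient_subring_fps_over:
  assumes "coefficient_subring S"
  shows "coefficient_subring (fps_over S)"
proof -
  interpret coefficient_subring S by fact
  show ?thesis
    by unfold_locales (auto simp: fps_over_def fps_mult_nth intro: zero one minus add mult sum)
qed

lemma one_plus_s_series_iff:
  "A \<in> one_plus_s_series R \<longleftrightarrow> fps_nth A 0 = 1 \<and> A \<in> fps_over (fps_over R)"
  by (simp add: one_plus_s_series_def fps_over_def)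

lemma fps_over_mono: "R \<subseteq> S \<Longrightarrow> fps_over R \<subseteq> fps_over S"
  by (auto simp: fps_over_def)

context coefficient_subring
begin

lemma power_sums_mem:
  assumes "power_sums A a" and "A \<in> fps_over S" and "k > 0"
  shows "a k \<in> S"
  using assms(3)
proof (induction k rule: less_induct)
  case (less k)
  then obtain n where n: "k = Suc n"
    by (cases k) auto
  show ?case
    unfolding n power_sums_Suc[OF assms(1)]
    using less.IH assms(2) n
    by (intro diff minus mult sum of_nat) (auto simp: fps_over_def)
qed

text \<open>
  Every series with constant term 1 is a product of binomials \<open>1 - x\<^sub>k s\<^sup>k\<close> with
  coordinates in the same ring, up to any given degree: \<open>x\<^sub>k\<close> corrects the coefficient of
  \<open>s\<^sup>k\<close> and leaves the lower ones alone.
\<close>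

lemma Witt_coordinates:
  assumes "A \<in> fps_over S" and "fps_nth A 0 = 1"
  shows "\<exists>x. (\<forall>k. x k \<in> S) \<and>
    (\<forall>i\<le>n. fps_nth A i = fps_nth (\<Prod>k\<in>{1..n}. 1 - fps_const (x k) * fps_X ^ k) i)"
proof (induction n)
  case 0
  show ?case
    using assms by (auto intro!: exI[of _ "\<lambda>_. 0"] zero)
next
  case (Suc n)
  interpret F: coefficient_subring "fps_over S"
    by (intro coefficient_subring_fps_over coefficient_subring_axioms)
  obtain x where x: "\<And>k. x k \<in> S"
      "\<And>i. i \<le> n \<Longrightarrow> fps_nth A i = fps_nth (\<Prod>k\<in>{1..n}. 1 - fps_const (x k) * fps_X ^ k) i"
    using Suc by auto
  define P where "P = (\<Prod>k\<in>{1..n}. 1 - fps_const (x k) * fps_X ^ k)"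
  have "P \<in> fps_over S"
    unfolding P_def
    by (intro F.prod F.diff F.one F.mult F.power)
       (auto simp: fps_over_def fps_X_def x zero one)
  define c where "c = fps_nth P (Suc n) - fps_nth A (Suc n)"
  have "c \<in> S"
    using \<open>P \<in> fps_over S\<close> assms(1) by (auto simp: c_def fps_over_def intro: diff)
  have P0: "fps_nth P 0 = 1"
    using x(2)[of 0] assms(2) by (simp add: P_def)
  have prod: "(\<Prod>k\<in>{1..Suc n}. 1 - fps_const ((x(Suc n := c)) k) * fps_X ^ k)
      = P * (1 - fps_const c * fps_X ^ Suc n)"
    unfolding P_def by (simp add: mult.commute)
  have "fps_nth A i = fps_nth (P * (1 - fps_const c * fps_X ^ Suc n)) i" if "i \<le> Suc n" for i
  proof -
    have "P * (1 - fps_const c * fps_X ^ Suc n) = P - fps_const c * (fps_X ^ Suc n * P)"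
      by (simp only: right_diff_distrib mult_1_left mult_1_right mult_ac)
    then have "fps_nth (P * (1 - fps_const c * fps_X ^ Suc n)) i
        = fps_nth P i - c * fps_nth (fps_X ^ Suc n * P) i"
      by (simp only: fps_sub_nth fps_mult_left_const_nth)
    also have "\<dots> = fps_nth A i"
      using that x(2)[of i] P0 unfolding fps_X_power_mult_nth
      by (cases "i = Suc n") (auto simp: c_def P_def)
    finally show ?thesis ..
  qed
  then show ?case
    using \<open>c \<in> S\<close> x(1) unfolding prod[symmetric]
    by (intro exI[of _ "x(Suc n := c)"]) auto
qed

end

text \<open>
  The exponential series involves denominators, but the tensor product is bimultiplicative, so in Witt
  coordinates it is a product of tensor products of binomials, which are integral. The coefficient of degree n
  depends on the power sums up to n only, so finitely many coordinates suffice.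
\<close>

lemma tensor_integral:
  fixes A B C :: "'r::{idom, semiring_char_0} fps"
  assumes "coefficient_subring S" and "A \<in> fps_over S" and "B \<in> fps_over S"
    and a: "power_sums A a" and b: "power_sums B b" and c: "power_sums C (\<lambda>k. a k * b k)"
  shows "C \<in> fps_over S"
proof -
  interpret coefficient_subring S by fact
  interpret F: coefficient_subring "fps_over S"
    by (intro coefficient_subring_fps_over coefficient_subring_axioms)
  have "fps_nth C n \<in> S" for n
  proof -
    have A0: "fps_nth A 0 = 1" and B0: "fps_nth B 0 = 1"
      using a b by (auto simp: power_sums_def)
    obtain x where x: "\<And>k. x k \<in> S"
        "\<And>i. i \<le> n \<Longrightarrow> fps_nth A i = fps_nth (\<Prod>k\<in>{1..n}. 1 - fps_const (x k) * fps_X ^ k) i"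
      using Witt_coordinates[OF assms(2) A0] by metis
    obtain y where y: "\<And>k. y k \<in> S"
        "\<And>i. i \<le> n \<Longrightarrow> fps_nth B i = fps_nth (\<Prod>k\<in>{1..n}. 1 - fps_const (y k) * fps_X ^ k) i"
      using Witt_coordinates[OF assms(3) B0] by metis
    define f g where "f = (\<lambda>k j. if k dvd j then of_nat k * x k ^ (j div k) else 0)"
      and "g = (\<lambda>k j. if k dvd j then of_nat k * y k ^ (j div k) else 0)"
    define Q where "Q = (\<Prod>(k, m)\<in>{1..n} \<times> {1..n}.
      (1 - fps_const (x k ^ (lcm k m div k) * y m ^ (lcm k m div m)) * fps_X ^ lcm k m) ^ gcd k m)"
    have pa: "power_sums (\<Prod>k\<in>{1..n}. 1 - fps_const (x k) * fps_X ^ k) (\<lambda>j. \<Sum>k\<in>{1..n}. f k j)"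
      unfolding f_def by (intro power_sums_prod power_sums_binomial) auto
    have pb: "power_sums (\<Prod>k\<in>{1..n}. 1 - fps_const (y k) * fps_X ^ k) (\<lambda>j. \<Sum>k\<in>{1..n}. g k j)"
      unfolding g_def by (intro power_sums_prod power_sums_binomial) auto
    have "power_sums Q (\<lambda>j. \<Sum>z\<in>{1..n} \<times> {1..n}. f (fst z) j * g (snd z) j)"
      unfolding Q_def f_def g_def case_prod_beta
      by (intro power_sums_prod power_sums_tensor_binomials) auto
    then have "power_sums Q (\<lambda>j. (\<Sum>k\<in>{1..n}. f k j) * (\<Sum>k\<in>{1..n}. g k j))"
      by (simp add: sum_product sum.cartesian_product case_prod_beta)
    then have "fps_nth C n = fps_nth Q n"
      using power_sums_eq_if_coeffs_eq[OF a pa x(2)] power_sums_eq_if_coeffs_eq[OF b pb y(2)]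
      by (intro coeffs_eq_if_power_sums_eq[OF c, where n = n]) auto
    moreover have "Q \<in> fps_over S"
      unfolding Q_def case_prod_beta
      by (intro F.prod F.power F.diff F.one F.mult)
         (auto simp: fps_over_def fps_X_def zero one intro!: mult power x y)
    ultimately show ?thesis
      by (simp add: fps_over_def)
  qed
  then show ?thesis
    by (simp add: fps_over_def)
qed

section \<open>Evaluation of power series on the open unit disc\<close>

definition eval_coeffs :: "'c::{comm_semiring_1, topological_space} \<Rightarrow> 'c fps fps \<Rightarrow> 'c fps" where
  "eval_coeffs t A = Abs_fps (\<lambda>i. eval_at t (fps_nth A i))"

lemma eval_coeffs_nth [simp]: "fps_nth (eval_coeffs t A) i = eval_at t (fps_nth A i)"
  by (simp add: eval_coeffs_def)

context padic_complex_field
begin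

definition unit_ball :: "'c set" where
  "unit_ball = {x. absv x \<le> 1}"

lemma unit_ball_subring: "coefficient_subring unit_ball"
proof
  show "x + y \<in> unit_ball" if "x \<in> unit_ball" "y \<in> unit_ball" for x y
    using that absv_ultrametric[of x y] by (simp add: unit_ball_def)
qed (auto simp: unit_ball_def absv_mult mult_le_one)

lemma absv_sum_terms_le:
  assumes "f \<in> fps_over unit_ball" and "absv t < 1" and "\<And>i. i \<in> I \<Longrightarrow> N \<le> i"
  shows "absv (\<Sum>i\<in>I. fps_nth f i * t ^ i) \<le> absv t ^ N"
proof (rule absv_sum_le)
  fix i assume "i \<in> I"
  then have "absv (fps_nth f i) * absv t ^ i \<le> 1 * absv t ^ N"
    using assms by (intro mult_mono power_decreasing) (auto simp: fps_over_def unit_ball_def)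
  then show "absv (fps_nth f i * t ^ i) \<le> absv t ^ N"
    by (simp add: absv_mult absv_power)
qed simp

lemma tendsto_absv_power: "absv (t :: 'c) < 1 \<Longrightarrow> (\<lambda>n. absv t ^ n) \<longlonglongrightarrow> 0"
  by (intro LIMSEQ_power_zero) simp

lemma eval_at_sums:
  assumes "f \<in> fps_over unit_ball" and "absv t < 1"
  shows "(\<lambda>n. fps_nth f n * t ^ n) sums eval_at t f"
proof -
  have "Cauchy (\<lambda>n. \<Sum>i<n. fps_nth f i * t ^ i)"
  proof (rule metric_CauchyI)
    fix e :: real assume "e > 0"
    then obtain N where N: "absv t ^ N < e"
      using order_tendstoD(2)[OF tendsto_absv_power[OF assms(2)], of e]
      by (auto simp: eventually_sequentially)
    have *: "absv ((\<Sum>i<n. fps_nth f i * t ^ i) - (\<Sum>i<m. fps_nth f i * t ^ i)) < e"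
      if "N \<le> m" "m \<le> n" for m n
    proof -
      have "(\<Sum>i<n. fps_nth f i * t ^ i) - (\<Sum>i<m. fps_nth f i * t ^ i)
          = (\<Sum>i\<in>{..<n} - {..<m}. fps_nth f i * t ^ i)"
        using that by (intro sum_diff[symmetric]) auto
      then show ?thesis
        using absv_sum_terms_le[OF assms, of "{..<n} - {..<m}" N] that N by auto
    qed
    have "dist (\<Sum>i<m. fps_nth f i * t ^ i) (\<Sum>i<n. fps_nth f i * t ^ i) < e"
      if "N \<le> m" "N \<le> n" for m n
      using *[of m n] *[of n m] that
      by (cases "m \<le> n") (auto simp: dist_absv absv_minus_commute)
    then show "\<exists>M. \<forall>m\<ge>M. \<forall>n\<ge>M. dist (\<Sum>i<m. fps_nth f i * t ^ i) (\<Sum>i<n. fps_nth f i * t ^ i) < e"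
      by blast
  qed
  then have "summable (\<lambda>n. fps_nth f n * t ^ n)"
    using Cauchy_convergent by (simp add: summable_iff_convergent)
  then show ?thesis
    unfolding eval_at_def by (rule summable_sums)
qed

lemma eval_at_approx:
  assumes "f \<in> fps_over unit_ball" and "absv t < 1"
  shows "absv (eval_at t f - (\<Sum>i<N. fps_nth f i * t ^ i)) \<le> absv t ^ N"
proof (rule LIMSEQ_le_const2)
  let ?s = "\<lambda>n. \<Sum>i<n. fps_nth f i * t ^ i"
  have "?s \<longlonglongrightarrow> eval_at t f"
    using eval_at_sums[OF assms] by (simp add: sums_def)
  then have "(\<lambda>n. ?s n + - ?s N) \<longlonglongrightarrow> eval_at t f + - ?s N"
    by (intro tendsto_add_padic tendsto_const)
  from tendsto_absv[OF this]
  show "(\<lambda>n. absv (?s n - ?s N)) \<longlonglongrightarrow> absv (eval_at t f - ?s N)"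
    by simp
  have "absv (?s n - ?s N) \<le> absv t ^ N" if "N \<le> n" for n
  proof -
    have "?s n - ?s N = (\<Sum>i\<in>{..<n} - {..<N}. fps_nth f i * t ^ i)"
      using that by (intro sum_diff[symmetric]) auto
    then show ?thesis
      using absv_sum_terms_le[OF assms, of "{..<n} - {..<N}" N] by auto
  qed
  then show "\<exists>N'. \<forall>n\<ge>N'. absv (?s n - ?s N) \<le> absv t ^ N"
    by blast
qed

text \<open>
  The bound for the tail of a power series with coefficients in the unit ball characterises its value.
\<close>

lemma eval_at_eqI:
  fixes x t :: 'c
  assumes "absv t < 1" and "\<And>N. absv (x - (\<Sum>i<N. fps_nth f i * t ^ i)) \<le> absv t ^ N"
  shows "eval_at t f = x"
proof -
  have "(\<lambda>N. absv ((\<Sum>i<N. fps_nth f i * t ^ i) - x)) \<longlonglongrightarrow> 0"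
    using assms(2)
    by (intro tendsto_sandwich[OF _ _ tendsto_const tendsto_absv_power[OF assms(1)]] always_eventually)
       (auto simp: absv_minus_commute)
  then have "(\<lambda>n. fps_nth f n * t ^ n) sums x"
    unfolding sums_def by (rule tendsto_iff_absv[THEN iffD2])
  then show ?thesis
    unfolding eval_at_def by (rule sums_unique[symmetric])
qed

lemma absv_eval_at_le_1:
  assumes "f \<in> fps_over unit_ball" and "absv t < 1"
  shows "absv (eval_at t f) \<le> 1"
  using eval_at_approx[OF assms, of 0] by simp

lemma eval_at_add:
  assumes "f \<in> fps_over unit_ball" and "g \<in> fps_over unit_ball" and "absv t < 1"
  shows "eval_at t (f + g) = eval_at t f + eval_at t g"
proof (rule eval_at_eqI)
  fix N
  show "absv (eval_at t f + eval_at t g - (\<Sum>i<N. fps_nth (f + g) i * t ^ i)) \<le> absv t ^ N"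
    using absv_ultrametric[of "eval_at t f - (\<Sum>i<N. fps_nth f i * t ^ i)"
        "eval_at t g - (\<Sum>i<N. fps_nth g i * t ^ i)"]
      eval_at_approx[OF assms(1,3), of N] eval_at_approx[OF assms(2,3), of N]
    by (simp add: algebra_simps sum.distrib)
qed fact

text \<open>
  Comparing the product of two partial sums with the partial sum of the Cauchy product leaves the terms with
  \<open>i < N\<close>, \<open>j < N\<close> and \<open>i + j \<ge> N\<close>, all of which are small.
\<close>

lemma eval_at_mult:
  assumes "f \<in> fps_over unit_ball" and "g \<in> fps_over unit_ball" and "absv t < 1"
  shows "eval_at t (f * g) = eval_at t f * eval_at t g"
proof (rule eval_at_eqI)
  fix N
  define F where "F = (\<Sum>i<N. fps_nth f i * t ^ i)"
  define G where "G = (\<Sum>i<N. fps_nth g i * t ^ i)"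
  let ?T = "{(i, j). i + j < N}"
  let ?h = "\<lambda>(i, j). (fps_nth f i * t ^ i) * (fps_nth g j * t ^ j)"
  have sub: "?T \<subseteq> {..<N} \<times> {..<N}"
    by auto
  have "(\<Sum>i<N. fps_nth (f * g) i * t ^ i)
      = (\<Sum>k<N. \<Sum>i\<le>k. (fps_nth f i * t ^ i) * (fps_nth g (k - i) * t ^ (k - i)))"
  proof (intro sum.cong refl)
    fix k
    have "fps_nth (f * g) k * t ^ k = (\<Sum>i\<le>k. fps_nth f i * fps_nth g (k - i) * t ^ (i + (k - i)))"
      by (simp add: fps_mult_nth atLeast0AtMost sum_distrib_right)
    also have "\<dots> = (\<Sum>i\<le>k. (fps_nth f i * t ^ i) * (fps_nth g (k - i) * t ^ (k - i)))"
      by (simp only: power_add mult_ac)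
    finally show "fps_nth (f * g) k * t ^ k
        = (\<Sum>i\<le>k. (fps_nth f i * t ^ i) * (fps_nth g (k - i) * t ^ (k - i)))" .
  qed
  also have "\<dots> = sum ?h ?T"
    by (rule sum.triangle_reindex[symmetric])
  finally have "F * G - (\<Sum>i<N. fps_nth (f * g) i * t ^ i) = sum ?h ({..<N} \<times> {..<N} - ?T)"
    using sub by (simp add: F_def G_def sum_product sum.cartesian_product sum_diff)
  moreover have "absv (sum ?h ({..<N} \<times> {..<N} - ?T)) \<le> absv t ^ N"
  proof (rule absv_sum_le)
    fix z assume "z \<in> {..<N} \<times> {..<N} - ?T"
    then obtain i j where z: "z = (i, j)" "N \<le> i + j"
      by (cases z) auto
    have "(absv (fps_nth f i) * absv (fps_nth g j)) * absv t ^ (i + j) \<le> (1 * 1) * absv t ^ N"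
      using assms z by (intro mult_mono power_decreasing) (auto simp: fps_over_def unit_ball_def)
    then show "absv (?h z) \<le> absv t ^ N"
      by (simp add: z absv_mult absv_power power_add mult_ac)
  qed simp
  ultimately have 1: "absv (F * G - (\<Sum>i<N. fps_nth (f * g) i * t ^ i)) \<le> absv t ^ N"
    by simp
  have "absv G \<le> 1"
    using absv_sum_terms_le[OF assms(2,3), of "{..<N}" 0] by (simp add: G_def)
  then have 2: "absv (eval_at t f * (eval_at t g - G)) \<le> absv t ^ N"
      "absv (G * (eval_at t f - F)) \<le> absv t ^ N"
    using eval_at_approx[OF assms(1,3), of N] eval_at_approx[OF assms(2,3), of N]
      mult_mono[of "absv (eval_at t f)" 1 "absv (eval_at t g - G)" "absv t ^ N"]
      mult_mono[of "absv G" 1 "absv (eval_at t f - F)" "absv t ^ N"]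
      absv_eval_at_le_1[OF assms(1,3)]
    by (auto simp: absv_mult F_def G_def)
  have "eval_at t f * eval_at t g - F * G = eval_at t f * (eval_at t g - G) + G * (eval_at t f - F)"
    by (simp add: algebra_simps)
  then have "absv (eval_at t f * eval_at t g - F * G) \<le> absv t ^ N"
    using 2 absv_ultrametric[of "eval_at t f * (eval_at t g - G)" "G * (eval_at t f - F)"] by simp
  then show "absv (eval_at t f * eval_at t g - (\<Sum>i<N. fps_nth (f * g) i * t ^ i)) \<le> absv t ^ N"
    using 1 absv_ultrametric[of "eval_at t f * eval_at t g - F * G"
        "F * G - (\<Sum>i<N. fps_nth (f * g) i * t ^ i)"] by simp
qed fact

lemma eval_at_const:
  fixes c t :: 'c
  assumes "c \<in> unit_ball" and "absv t < 1"
  shows "eval_at t (fps_const c) = c"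
proof (rule eval_at_eqI)
  fix N
  show "absv (c - (\<Sum>i<N. fps_nth (fps_const c) i * t ^ i)) \<le> absv t ^ N"
  proof (cases N)
    case 0
    then show ?thesis
      using assms by (simp add: unit_ball_def)
  next
    case (Suc m)
    then show ?thesis
      by (simp only: sum.lessThan_Suc_shift) simp
  qed
qed fact

lemma eval_at_of_nat: "absv (t :: 'c) < 1 \<Longrightarrow> eval_at t (of_nat n) = of_nat n"
  using eval_at_const[of "of_nat n" t] coefficient_subring.of_nat[OF unit_ball_subring]
  by (simp add: fps_of_nat)

lemma eval_at_sum:
  fixes t :: 'c
  assumes "\<And>i. i \<in> I \<Longrightarrow> f i \<in> fps_over unit_ball" and "absv t < 1"
  shows "eval_at t (\<Sum>i\<in>I. f i) = (\<Sum>i\<in>I. eval_at t (f i))"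
  using assms
proof (induction I rule: infinite_finite_induct)
  case (insert i I)
  interpret F: coefficient_subring "fps_over unit_ball"
    by (intro coefficient_subring_fps_over unit_ball_subring)
  show ?case
    using insert by (simp add: eval_at_add F.sum)
qed (use eval_at_of_nat[of t 0] in auto)

lemma eval_at_power:
  assumes "f \<in> fps_over unit_ball" and "absv (t :: 'c) < 1"
  shows "eval_at t (f ^ n) = eval_at t f ^ n"
proof (induction n)
  case 0
  then show ?case
    using eval_at_of_nat[of t 1] assms by simp
next
  case (Suc n)
  interpret F: coefficient_subring "fps_over unit_ball"
    by (intro coefficient_subring_fps_over unit_ball_subring)
  show ?case
    using Suc assms by (simp add: eval_at_mult F.power)
qed

lemma eval_at_X:
  fixes t :: 'c
  assumes "absv t < 1"
  shows "eval_at t fps_X = t"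
proof (rule eval_at_eqI)
  fix N
  show "absv (t - (\<Sum>i<N. fps_nth fps_X i * t ^ i)) \<le> absv t ^ N"
  proof (cases "N \<le> 1")
    case True
    then show ?thesis
      using assms by (cases N) (auto simp: fps_X_def)
  next
    case False
    then obtain m where "N = Suc (Suc m)"
      by (metis One_nat_def not_less_eq_eq le0 not0_implies_Suc old.nat.exhaust)
    then show ?thesis
      by (simp only: sum.lessThan_Suc_shift) (simp add: fps_X_def)
  qed
qed fact

text \<open>
  The value is a power of t times the value of a series with nonzero constant term, and that value is close to
  the constant term.
\<close>

lemma eval_at_factor_subdegree:
  fixes t :: 'c
  assumes "f \<in> fps_over unit_ball" and "absv t < 1"
  shows "eval_at t f = t ^ subdegree f * eval_at t (unit_factor f)"
    and "absv (eval_at t (unit_factor f) - fps_nth f (subdegree f)) \<le> absv t"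
    and "absv (eval_at t (unit_factor f)) \<le> 1"
proof -
  have X: "fps_X \<in> fps_over unit_ball"
    by (auto simp: fps_over_def unit_ball_def fps_X_def)
  interpret F: coefficient_subring "fps_over unit_ball"
    by (intro coefficient_subring_fps_over unit_ball_subring)
  let ?g = "unit_factor f"
  have g: "?g \<in> fps_over unit_ball"
    using assms(1) by (auto simp: fps_over_def)
  have "f = fps_X ^ subdegree f * ?g"
    by (metis fps_unit_factor_def mult.commute subdegree_decompose)
  then show "eval_at t f = t ^ subdegree f * eval_at t ?g"
    using eval_at_mult[OF F.power[OF X, of "subdegree f"] g assms(2)] eval_at_power[OF X assms(2)]
      eval_at_X[OF assms(2)] by metis
  show "absv (eval_at t ?g - fps_nth f (subdegree f)) \<le> absv t"
    using eval_at_approx[OF g assms(2), of 1] by simp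
  show "absv (eval_at t ?g) \<le> 1"
    by (rule absv_eval_at_le_1[OF g assms(2)])
qed

lemma ord_T_le_ord_at:
  fixes t :: 'c
  assumes "f \<in> fps_over unit_ball" and "absv t < 1" and "t \<noteq> 0"
  shows "ord_T f \<le> ord_at t (eval_at t f)"
proof (cases "eval_at t f = 0")
  case False
  let ?e = "eval_at t (unit_factor f)"
  have e: "?e \<noteq> 0" "f \<noteq> 0"
    using False eval_at_factor_subdegree(1)[OF assms(1,2)] eval_at_of_nat[OF assms(2), of 0] by auto
  have "ln (absv ?e) / ln (absv t) \<ge> 0"
    using eval_at_factor_subdegree(3)[OF assms(1,2)] assms e by (intro divide_nonpos_nonpos) auto
  moreover have "ln (absv (eval_at t f)) / ln (absv t) = subdegree f + ln (absv ?e) / ln (absv t)"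
    using assms e eval_at_factor_subdegree(1)[OF assms(1,2)]
    by (simp add: absv_mult absv_power ln_mult ln_realpow field_simps)
  ultimately show ?thesis
    using False e by (simp add: ord_T_def ord_at_def)
qed (simp add: ord_at_def)

lemma absv_p_power: "absv (of_nat p ^ k :: 'c) = (1 / real p) ^ k"
proof -
  have "absv (of_nat p :: 'c) = 1 / real p"
    using absv_of_nat[of p] prime_p by (simp add: prime_gt_0_nat)
  then show ?thesis
    by (simp add: absv_power)
qed

text \<open>
  As t tends to 0 along the powers of p, the valuation of f(t) tends to the T-adic valuation of f: once |t| is
  smaller than the absolute value of the lowest coefficient c, the value f(t) has absolute value |t|^d |c|
  with d the lowest degree, and \<open>ln |c| / ln |t|\<close> tends to 0.
\<close>

lemma le_ord_T_if_le_ord_at: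
  assumes "f \<in> fps_over unit_ball"
    and "\<And>t :: 'c. t \<noteq> 0 \<Longrightarrow> absv t < 1 \<Longrightarrow> ereal x \<le> ord_at t (eval_at t f)"
  shows "ereal x \<le> ord_T f"
proof (cases "f = 0")
  case False
  define c where "c = fps_nth f (subdegree f)"
  have c: "c \<noteq> 0"
    using False by (simp add: c_def)
  have p: "real p > 1"
    using prime_gt_1_nat[OF prime_p] by simp
  have "(\<lambda>k. (1 / real p) ^ k) \<longlonglongrightarrow> 0"
    using p by (intro LIMSEQ_power_zero) simp
  then have "\<forall>\<^sub>F k in sequentially. (1 / real p) ^ k < absv c"
    using order_tendstoD(2) c by (metis absv_pos_iff)
  then have "\<forall>\<^sub>F k in sequentially. x \<le> real (subdegree f) + (- ln (absv c) / ln (real p)) / real k"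
    using eventually_gt_at_top[of 0]
  proof eventually_elim
    case (elim k)
    let ?t = "of_nat p ^ k :: 'c"
    have t: "absv ?t < 1" "?t \<noteq> 0"
      using p elim(2) by (auto simp: absv_p_power power_less_one_iff)
    let ?e = "eval_at ?t (unit_factor f)"
    have "absv (c - ?e) < absv c"
      using elim(1) eval_at_factor_subdegree(2)[OF assms(1) t(1)]
      by (simp add: c_def absv_p_power absv_minus_commute)
    then have e: "absv ?e = absv c"
      by (rule absv_eqI)
    have eval: "absv (eval_at ?t f) = absv ?t ^ subdegree f * absv c"
      using eval_at_factor_subdegree(1)[OF assms(1) t(1)] e by (simp add: absv_mult absv_power)
    have ln: "ln (absv ?t) = - (real k * ln (real p))"
      using p by (simp add: absv_p_power ln_realpow ln_div)
    have "ln (absv ?t) \<noteq> 0"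
      unfolding ln using p elim(2) by simp
    moreover have "ln (absv (eval_at ?t f)) = real (subdegree f) * ln (absv ?t) + ln (absv c)"
    proof -
      have "ln (T ^ m * C) = real m * ln T + ln C" if "T > 0" "C > 0" for T C :: real and m
        using that by (simp add: ln_mult ln_realpow)
      moreover have "absv ?t > 0" "absv c > 0"
        using t(2) c by (simp_all only: absv_pos_iff) simp_all
      ultimately show ?thesis
        unfolding eval by blast
    qed
    ultimately have "ln (absv (eval_at ?t f)) / ln (absv ?t)
        = real (subdegree f) + ln (absv c) / ln (absv ?t)"
      by (simp add: add_divide_distrib)
    moreover have "eval_at ?t f \<noteq> 0"
      using eval c t(2) by (metis absv_eq_0_iff mult_eq_0_iff power_eq_0_iff)
    ultimately show ?case
      using assms(2)[OF t(2,1)] by (simp add: ord_at_def ln mult.commute)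
  qed
  moreover have "(\<lambda>k. real (subdegree f) + (- ln (absv c) / ln (real p)) / real k)
      \<longlonglongrightarrow> real (subdegree f) + 0"
    by (intro tendsto_add tendsto_const lim_const_over_n)
  ultimately have "x \<le> real (subdegree f) + 0"
    by (intro tendsto_lowerbound) auto
  then show ?thesis
    using False by (simp add: ord_T_def)
qed (simp add: ord_T_def)

lemma eval_coeffs_mult:
  fixes t :: 'c
  assumes "A \<in> fps_over (fps_over unit_ball)" and "B \<in> fps_over (fps_over unit_ball)"
    and "absv t < 1"
  shows "eval_coeffs t (A * B) = eval_coeffs t A * eval_coeffs t B"
proof (rule fps_ext)
  fix n
  interpret F: coefficient_subring "fps_over unit_ball"
    by (intro coefficient_subring_fps_over unit_ball_subring)
  have AB: "fps_nth A i \<in> fps_over unit_ball" "fps_nth B i \<in> fps_over unit_ball" for i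
    using assms by (auto simp: fps_over_def)
  have "eval_at t (fps_nth (A * B) n)
      = (\<Sum>i=0..n. eval_at t (fps_nth A i * fps_nth B (n - i)))"
    unfolding fps_mult_nth using assms(3) AB by (intro eval_at_sum F.mult)
  then show "fps_nth (eval_coeffs t (A * B)) n = fps_nth (eval_coeffs t A * eval_coeffs t B) n"
    using assms(3) AB by (simp add: fps_mult_nth eval_at_mult)
qed

lemma power_sums_eval_coeffs:
  fixes t :: 'c
  assumes "power_sums A a" and "A \<in> fps_over (fps_over unit_ball)" and "absv t < 1"
  shows "power_sums (eval_coeffs t A) (\<lambda>k. eval_at t (a k))"
proof (rule power_sumsI)
  interpret F: coefficient_subring "fps_over unit_ball"
    by (intro coefficient_subring_fps_over unit_ball_subring)
  have A: "fps_nth A i \<in> fps_over unit_ball" for i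
    using assms(2) by (simp add: fps_over_def)
  have a: "a (Suc k) \<in> fps_over unit_ball" for k
    by (intro F.power_sums_mem[OF assms(1,2)]) simp
  show "fps_nth (eval_coeffs t A) 0 = 1"
    using assms(1) eval_at_of_nat[OF assms(3), of 1] by (simp add: power_sums_def)
  fix n
  have "eval_at t (of_nat (Suc n) * fps_nth A (Suc n) + (\<Sum>i\<le>n. fps_nth A i * a (Suc (n - i))))
      = of_nat (Suc n) * eval_at t (fps_nth A (Suc n))
        + (\<Sum>i\<le>n. eval_at t (fps_nth A i) * eval_at t (a (Suc (n - i))))"
    using A a assms(3) F.of_nat
    by (simp add: eval_at_add eval_at_mult eval_at_sum eval_at_of_nat F.mult F.sum del: of_nat_Suc)
  then show "of_nat (Suc n) * fps_nth (eval_coeffs t A) (Suc n)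
      + (\<Sum>i\<le>n. fps_nth (eval_coeffs t A) i * eval_at t (a (Suc (n - i)))) = 0"
    using newton_identity[OF assms(1), of n] eval_at_of_nat[OF assms(3), of 0] by simp
qed

end

section \<open>Newton polygons and Legendre transforms\<close>

text \<open>
  The Legendre transform of v at l, as a relation: the minimum over i of \<open>v i + l * i\<close> exists and
  is the real number m. Graphically, m is the intercept of the supporting line of slope \<open>- l\<close>.
\<close>

definition legendre_min :: "(nat \<Rightarrow> ereal) \<Rightarrow> real \<Rightarrow> real \<Rightarrow> bool" where
  "legendre_min v l m \<longleftrightarrow>
     (\<forall>i. ereal m \<le> v i + ereal (l * real i)) \<and> (\<exists>i. v i + ereal (l * real i) = ereal m)"

definition superlinear :: "(nat \<Rightarrow> ereal) \<Rightarrow> bool" where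
  "superlinear v \<longleftrightarrow> (\<forall>c. \<forall>\<^sub>F i in sequentially. ereal (c * real i) \<le> v i)"

abbreviation newton_points :: "(nat \<Rightarrow> ereal) \<Rightarrow> (real \<times> real) set" where
  "newton_points v \<equiv> {(real i, y) | i y. v i = ereal y}"

lemma legendre_min_exists:
  assumes "superlinear v" and "v 0 = 0" and "\<And>i. v i \<noteq> -\<infinity>"
  shows "\<exists>m. legendre_min v l m"
proof -
  obtain N where N: "\<And>i. i \<ge> N \<Longrightarrow> ereal (- l * real i) \<le> v i"
    using assms(1) unfolding superlinear_def eventually_sequentially by meson
  define f where "f = (\<lambda>i. v i + ereal (l * real i))"
  define M where "M = Min (f ` {..N})"
  have f0: "f 0 = 0"
    using assms(2) by (simp add: f_def zero_ereal_def)
  have le: "M \<le> f i" if "i \<le> N" for i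
    unfolding M_def using that by (intro Min_le) auto
  have "M \<in> f ` {..N}"
    unfolding M_def by (intro Min_in) auto
  then obtain k where k: "M = f k"
    by auto
  have "f k \<noteq> -\<infinity>"
    using assms(3)[of k] by (simp add: f_def)
  moreover have "f k \<noteq> \<infinity>"
    using le[of 0] f0 k by auto
  ultimately obtain m where m: "f k = ereal m"
    by (cases "f k") auto
  have "ereal m \<le> f i" for i
  proof (cases "i \<le> N")
    case False
    then have "ereal (- l * real i) + ereal (l * real i) \<le> f i"
      unfolding f_def using N[of i] by (intro add_right_mono) auto
    then have "0 \<le> f i"
      by (simp flip: zero_ereal_def)
    moreover have "ereal m \<le> 0"
      using le[of 0] unfolding f0 k m by simp
    ultimately show ?thesis
      by (rule order_trans[rotated])
  qed (use le k m in auto)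
  with m show ?thesis
    unfolding legendre_min_def f_def by blast
qed

lemma newton_polygon_le:
  "v i = ereal y \<Longrightarrow> newton_polygon v (real i) \<le> ereal y"
  unfolding newton_polygon_def by (intro INF_lower) (auto intro!: hull_inc)

text \<open>
  The half plane above a supporting line is convex, so it contains the hull once it contains the points.
\<close>

lemma le_newton_polygon:
  assumes "legendre_min v l m"
  shows "ereal (m - l * x) \<le> newton_polygon v x"
proof -
  have "newton_points v \<subseteq> {z. inner (l, 1) z \<ge> m}"
  proof
    fix z assume "z \<in> newton_points v"
    then obtain i y where z: "z = (real i, y)" "v i = ereal y"
      by auto
    have "ereal m \<le> v i + ereal (l * real i)"
      using assms by (simp add: legendre_min_def)
    then show "z \<in> {z. inner (l, 1) z \<ge> m}"
      by (simp add: z inner_Pair)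
  qed
  then have "convex hull newton_points v \<subseteq> {z. inner (l, 1) z \<ge> m}"
    by (intro hull_minimal convex_halfspace_ge)
  then have "m - l * x \<le> y" if "(x, y) \<in> convex hull newton_points v" for y
    using subsetD[of _ _ "(x, y)"] that by (fastforce simp: inner_Pair)
  then show ?thesis
    unfolding newton_polygon_def by (intro INF_greatest) simp
qed

text \<open>
  The supporting lines of v lie below the common polygon, hence below the points of v'.
\<close>

lemma legendre_min_le_if_newton_polygon_eq:
  assumes "newton_polygon v = newton_polygon v'" and "legendre_min v l m" and "legendre_min v' l m'"
  shows "m \<le> m'"
proof -
  obtain i where i: "v' i + ereal (l * real i) = ereal m'"
    using assms(3) by (auto simp: legendre_min_def)
  then obtain y where y: "v' i = ereal y"
    by (cases "v' i") auto
  have "ereal (m - l * real i) \<le> newton_polygon v (real i)"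
    by (rule le_newton_polygon[OF assms(2)])
  also have "\<dots> \<le> ereal y"
    unfolding assms(1) by (rule newton_polygon_le[of v', OF y])
  finally show ?thesis
    using i y by simp
qed

lemma legendre_min_unique_if_newton_polygon_eq:
  assumes "newton_polygon v = newton_polygon v'" and "legendre_min v l m" and "legendre_min v' l m'"
  shows "m = m'"
  using legendre_min_le_if_newton_polygon_eq[OF assms]
    legendre_min_le_if_newton_polygon_eq[OF assms(1)[symmetric] assms(3,2)] by simp

text \<open>
  The core of Legendre duality. Unless v' has a point at or directly below (i, a), every line through (i, a) has a
  point of v' with another abscissa on or below it, because both transforms agree. Such a point lies on the
  left for steeply descending lines. Turn the line upwards until the last point j1 on the left is about to be
  lost; just beyond, there must be a point on the right. The chord between the two passes below (i, a) up to
  an error \<open>\<epsilon>\<close> that accounts for turning past the critical slope.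
\<close>

lemma almost_below_point_in_hull:
  assumes "\<And>l. legendre_min v l (\<phi> l)" and "\<And>l. legendre_min v' l (\<phi> l)"
    and "v i = ereal a" and "\<epsilon> > 0"
  shows "\<exists>b \<le> a + \<epsilon>. (real i, b) \<in> convex hull newton_points v'"
proof (cases "\<exists>w. v' i = ereal w \<and> w \<le> a")
  case True
  then obtain w where "v' i = ereal w" "w \<le> a"
    by blast
  then show ?thesis
    using assms(4) by (intro exI[of _ w]) (auto intro!: hull_inc)
next
  case False
  have le: "\<phi> l \<le> a + l * real i" for l
    using assms(1)[of l] assms(3) by (auto simp: legendre_min_def dest!: spec[of _ i])
  have ex: "\<exists>j w. j \<noteq> i \<and> v' j = ereal w \<and> w + l * real j \<le> a + l * real i" for l
  proof -
    obtain j where j: "v' j + ereal (l * real j) = ereal (\<phi> l)"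
      using assms(2)[of l] by (auto simp: legendre_min_def)
    then obtain w where w: "v' j = ereal w"
      by (cases "v' j") auto
    with j have "w + l * real j \<le> a + l * real i"
      using le[of l] by simp
    moreover from this have "j \<noteq> i"
      using w False by auto
    ultimately show ?thesis
      using w by blast
  qed
  define J where "J = {j. j < i \<and> (\<exists>w. v' j = ereal w)}"
  define \<sigma> where "\<sigma> = (\<lambda>j. (real_of_ereal (v' j) - a) / (real i - real j))"
  have "J \<noteq> {}"
  proof
    assume J: "J = {}"
    \<comment> \<open>With all points on the right, a line this steep would force one of them below the bound \<open>\<phi> 0\<close>.\<close>
    obtain j w where j: "j \<noteq> i" "v' j = ereal w"
        "w + (a - \<phi> 0 + 1) * real j \<le> a + (a - \<phi> 0 + 1) * real i"
      using ex by blast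
    have "ereal (\<phi> 0) \<le> v' j + ereal (0 * real j)"
      using assms(2)[of 0] unfolding legendre_min_def by blast
    then have "\<phi> 0 \<le> w"
      using j(2) by simp
    have "real i + 1 \<le> real j"
      using j J by (cases "i < j") (auto simp: J_def)
    then have "(a - \<phi> 0 + 1) * 1 \<le> (a - \<phi> 0 + 1) * (real j - real i)"
      using le[of 0] by (intro mult_left_mono) auto
    then show False
      using j(3) \<open>\<phi> 0 \<le> w\<close> by (simp add: algebra_simps)
  qed
  moreover have "finite J"
    by (simp add: J_def)
  ultimately have "Min (\<sigma> ` J) \<in> \<sigma> ` J"
    by (intro Min_in) auto
  then obtain j1 where j1: "j1 \<in> J" "\<sigma> j1 = Min (\<sigma> ` J)"
    by auto
  have min: "\<sigma> j1 \<le> \<sigma> j" if "j \<in> J" for j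
    using that \<open>finite J\<close> by (simp add: j1(2))
  obtain w1 where w1: "v' j1 = ereal w1" "j1 < i"
    using j1(1) by (auto simp: J_def)
  \<comment> \<open>Dividing by i makes the error of the chord at most \<open>\<epsilon>\<close>, as the weight of j1 times \<open>i - j1\<close> is at most i.\<close>
  define l where "l = \<sigma> j1 - \<epsilon> / real i"
  have "i > 0"
    using w1(2) by simp
  then have "l < \<sigma> j1"
    using assms(4) by (simp add: l_def)
  obtain j w where j: "j \<noteq> i" "v' j = ereal w" "w + l * real j \<le> a + l * real i"
    using ex by blast
  have "i < j"
  proof (rule ccontr)
    assume "\<not> i < j"
    with j(1) have "j < i"
      by simp
    then have "\<sigma> j \<le> l"
      using j(2,3) by (simp add: \<sigma>_def divide_le_eq algebra_simps)
    moreover have "j \<in> J"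
      using \<open>j < i\<close> j(2) by (simp add: J_def)
    ultimately show False
      using min[of j] \<open>l < \<sigma> j1\<close> by simp
  qed
  define u where "u = (real j - real i) / (real j - real j1)"
  have u: "0 \<le> u" "u \<le> 1" and u': "1 - u = (real i - real j1) / (real j - real j1)"
    using w1(2) \<open>i < j\<close> by (auto simp: u_def field_simps)
  have cross: "u * (real i - real j1) = (1 - u) * (real j - real i)"
    unfolding u' by (simp add: u_def)
  have "u *\<^sub>R (real j1, w1) + (1 - u) *\<^sub>R (real j, w) \<in> convex hull newton_points v'"
    using u w1 j by (intro convexD convex_convex_hull hull_inc) auto
  moreover have "u * real j1 + (1 - u) * real j = real i"
    using cross by (simp add: algebra_simps)
  ultimately have "(real i, u * w1 + (1 - u) * w) \<in> convex hull newton_points v'"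
    by simp
  moreover have "u * w1 + (1 - u) * w \<le> a + \<epsilon>"
  proof -
    have "w1 = a + \<sigma> j1 * (real i - real j1)"
      using w1 by (simp add: \<sigma>_def)
    moreover have "(1 - u) * w \<le> (1 - u) * (a - l * (real j - real i))"
      using j(3) u by (intro mult_left_mono) (auto simp: algebra_simps)
    ultimately have "u * w1 + (1 - u) * w
        \<le> u * (a + \<sigma> j1 * (real i - real j1)) + (1 - u) * (a - l * (real j - real i))"
      by simp
    also have "\<dots> = a + \<sigma> j1 * (u * (real i - real j1)) - l * ((1 - u) * (real j - real i))"
      by (simp add: algebra_simps)
    also have "\<dots> = a + u * (real i - real j1) * (\<epsilon> / real i)"
      unfolding cross[symmetric] l_def by (simp add: algebra_simps)
    also have "u * (real i - real j1) * (\<epsilon> / real i) \<le> 1 * real i * (\<epsilon> / real i)"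
      using u assms(4) w1(2) by (intro mult_right_mono mult_mono) auto
    finally show ?thesis
      using \<open>i > 0\<close> by simp
  qed
  ultimately show ?thesis
    by blast
qed

text \<open>
  The region above the closure of the hull of v' is convex, so it contains the hull of v once it contains the
  points of v.
\<close>

lemma newton_polygon_le_if_legendre_min_eq:
  assumes "\<And>l. legendre_min v l (\<phi> l)" and "\<And>l. legendre_min v' l (\<phi> l)"
  shows "newton_polygon v' x \<le> newton_polygon v x"
proof -
  let ?H = "convex hull newton_points v'"
  let ?E = "{z. \<forall>\<epsilon>>0. \<exists>b \<le> snd z + \<epsilon>. (fst z, b) \<in> ?H}"
  have "convex ?E"
  proof (rule convexI)
    fix z z' and s t :: real
    assume z: "z \<in> ?E" "z' \<in> ?E" and st: "0 \<le> s" "0 \<le> t" "s + t = 1"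
    have "\<exists>b \<le> snd (s *\<^sub>R z + t *\<^sub>R z') + \<epsilon>. (fst (s *\<^sub>R z + t *\<^sub>R z'), b) \<in> ?H" if \<epsilon>: "\<epsilon> > 0" for \<epsilon>
    proof -
      obtain b b' where b: "b \<le> snd z + \<epsilon>" "(fst z, b) \<in> ?H" "b' \<le> snd z' + \<epsilon>" "(fst z', b') \<in> ?H"
        using z \<epsilon> by blast
      have "s *\<^sub>R (fst z, b) + t *\<^sub>R (fst z', b') \<in> ?H"
        using b st by (intro convexD convex_convex_hull)
      moreover have "s * b + t * b' \<le> s * (snd z + \<epsilon>) + t * (snd z' + \<epsilon>)"
        using b st by (intro add_mono mult_left_mono)
      moreover have "s * (snd z + \<epsilon>) + t * (snd z' + \<epsilon>) = s * snd z + t * snd z' + (s + t) * \<epsilon>"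
        by (simp add: algebra_simps)
      ultimately show ?thesis
        using st(3) by (intro exI[of _ "s * b + t * b'"]) simp
    qed
    then show "s *\<^sub>R z + t *\<^sub>R z' \<in> ?E"
      by blast
  qed
  moreover have "newton_points v \<subseteq> ?E"
    using almost_below_point_in_hull[OF assms] by auto
  ultimately have sub: "convex hull newton_points v \<subseteq> ?E"
    by (intro hull_minimal)
  show ?thesis
    unfolding newton_polygon_def[of v]
  proof (rule INF_greatest)
    fix y assume "y \<in> {y. (x, y) \<in> convex hull newton_points v}"
    then have *: "\<forall>\<epsilon>>0. \<exists>b \<le> y + \<epsilon>. (x, b) \<in> ?H"
      using sub by auto
    show "newton_polygon v' x \<le> ereal y"
    proof (rule ereal_le_epsilon2)
      fix \<epsilon> :: real assume "0 < \<epsilon>"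
      then obtain b where "b \<le> y + \<epsilon>" "(x, b) \<in> ?H"
        using * by blast
      then show "newton_polygon v' x \<le> ereal y + ereal \<epsilon>"
        unfolding newton_polygon_def by (intro INF_lower2[of b]) auto
    qed
  qed
qed

lemma newton_polygon_eq_if_legendre_min_eq:
  assumes "\<And>l. legendre_min v l (\<phi> l)" and "\<And>l. legendre_min v' l (\<phi> l)"
  shows "newton_polygon v = newton_polygon v'"
  using newton_polygon_le_if_legendre_min_eq[OF assms]
    newton_polygon_le_if_legendre_min_eq[OF assms(2,1)] by (intro ext antisym)

lemma T_adic_entire_iff_superlinear:
  "T_adic_entire A \<longleftrightarrow> superlinear (\<lambda>i. ord_T (fps_nth A i))"
proof -
  have "ereal (c * real i) \<le> x \<longleftrightarrow> ereal c \<le> x / ereal (real i)" if "i > 0" for c i and x :: ereal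
    using that by (cases x) (auto simp: field_simps)
  then have "(\<forall>\<^sub>F i in sequentially. ereal (c * real i) \<le> ord_T (fps_nth A i))
      \<longleftrightarrow> (\<forall>\<^sub>F i in sequentially. ereal c \<le> ord_T (fps_nth A i) / ereal (real i))" for c
    by (intro eventually_cong eventually_mono[OF eventually_gt_at_top[of 0]]) auto
  moreover have "f \<longlonglongrightarrow> \<infinity> \<longleftrightarrow> (\<forall>c. \<forall>\<^sub>F i in sequentially. ereal c \<le> f i)" for f :: "nat \<Rightarrow> ereal"
    unfolding tendsto_PInfty
  proof (intro iffI allI)
    fix c assume "\<forall>c. \<forall>\<^sub>F i in sequentially. ereal c < f i"
    then have "\<forall>\<^sub>F i in sequentially. ereal c < f i"
      by blast
    then show "\<forall>\<^sub>F i in sequentially. ereal c \<le> f i"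
      by eventually_elim simp
  next
    fix c assume "\<forall>c. \<forall>\<^sub>F i in sequentially. ereal c \<le> f i"
    then have "\<forall>\<^sub>F i in sequentially. ereal (c + 1) \<le> f i"
      by blast
    then show "\<forall>\<^sub>F i in sequentially. ereal c < f i"
      by eventually_elim (auto intro: less_le_trans[of _ "ereal (c + 1)"])
  qed
  ultimately show ?thesis
    unfolding T_adic_entire_def superlinear_def by simp
qed

section \<open>Stability in terms of Gauss norms\<close>

lemma powr_le_powr_iff_base_less_one:
  fixes \<theta> :: real
  assumes "0 < \<theta>" and "\<theta> < 1"
  shows "\<theta> powr a \<le> \<theta> powr b \<longleftrightarrow> b \<le> a"
  using assms by (auto simp: powr_def mult_le_cancel_right)

context padic_complex_field
begin

text \<open>
  The Gauss norm of A on the disc of radius r, as a relation: the supremum of \<open>|A\<^sub>n| r^n\<close>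
  is attained and equals D. The index where it is attained is what the proof of multiplicativity works with,
  and it corresponds to the vertex of the Newton polygon that lies on the supporting line.
\<close>

definition gauss_max :: "'c fps \<Rightarrow> real \<Rightarrow> real \<Rightarrow> bool" where
  "gauss_max A r D \<longleftrightarrow> (\<forall>n. absv (fps_nth A n) * r ^ n \<le> D) \<and> (\<exists>n. absv (fps_nth A n) * r ^ n = D)"

text \<open>
  Raising |t| to a valuation turns the Legendre transform into the Gauss norm; the order is reversed since |t|
  < 1.
\<close>

lemma legendre_min_ord_at_iff:
  fixes t :: 'c
  assumes "t \<noteq> 0" and "absv t < 1"
  shows "legendre_min (\<lambda>i. ord_at t (fps_nth A i)) l m
    \<longleftrightarrow> gauss_max A (absv t powr l) (absv t powr m)"
proof -
  have le: "ereal m \<le> ord_at t x + ereal (l * real i)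
      \<longleftrightarrow> absv x * (absv t powr l) ^ i \<le> absv t powr m" (is ?le)
    and eq: "ord_at t x + ereal (l * real i) = ereal m
      \<longleftrightarrow> absv x * (absv t powr l) ^ i = absv t powr m" (is ?eq) for x i
  proof -
    define o' where "o' = ln (absv x) / ln (absv t)"
    have *: "absv x * (absv t powr l) ^ i = absv t powr (o' + l * real i)" if "x \<noteq> 0"
    proof -
      have "absv t powr o' = absv x"
        using that assms by (simp add: o'_def powr_def)
      then show ?thesis
        using assms by (simp add: powr_add powr_powr flip: powr_realpow)
    qed
    have ord: "ord_at t x = ereal o'" if "x \<noteq> 0"
      using that by (simp add: ord_at_def o'_def)
    have t: "0 < absv t" "absv t powr m > 0"
      using assms by simp_all
    note iff = powr_le_powr_iff_base_less_one[OF t(1) assms(2)]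
    show ?le
    proof (cases "x = 0")
      case False
      then show ?thesis
        unfolding *[OF False] ord[OF False] iff by simp
    qed (use t in \<open>simp add: ord_at_def\<close>)
    show ?eq
    proof (cases "x = 0")
      case False
      then show ?thesis
        unfolding *[OF False] ord[OF False] order_eq_iff[of "absv t powr _"] iff by auto
    qed (use t in \<open>simp add: ord_at_def\<close>)
  qed
  show ?thesis
    unfolding legendre_min_def gauss_max_def le eq ..
qed

text \<open>
  The workable form of stability: the Gauss norm of A(s,t) at radius \<open>|t|^l\<close> is
  \<open>|t|^\<phi>(l)\<close> with an exponent that is the same for all t.

  If A is stable, \<open>\<phi>\<close> is the Legendre transform of the T-adic polygon. Conversely, the bound
  \<open>ord\<^sub>t a\<^sub>i(t) \<ge> \<phi>(l) - l i\<close> for all t passes to the T-adic valuation as t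
  tends to 0. Since l is arbitrary, this gives both T-adic entireness and one half of the statement that
  \<open>\<phi>\<close> is the T-adic Legendre transform; the other half holds because evaluation can only
  increase the valuation. By duality the polygons then agree.
\<close>

lemma stable_series_iff:
  assumes "R \<subseteq> unit_ball"
  shows "stable_series R A \<longleftrightarrow> A \<in> one_plus_s_series R \<and>
    (\<exists>\<phi>. \<forall>t l. t \<noteq> 0 \<longrightarrow> absv t < 1 \<longrightarrow>
      gauss_max (eval_coeffs t A) (absv t powr l) (absv t powr \<phi> l))"
proof (cases "A \<in> one_plus_s_series R")
  case True
  then have A0: "fps_nth A 0 = 1" and A: "fps_nth A i \<in> fps_over unit_ball" for i
    using assms by (auto simp: one_plus_s_series_def fps_over_def)
  let ?T = "\<lambda>i. ord_T (fps_nth A i)" and ?t = "\<lambda>t i. ord_at t (eval_at t (fps_nth A i))"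
  have gauss: "gauss_max (eval_coeffs t A) (absv t powr l) (absv t powr m) \<longleftrightarrow> legendre_min (?t t) l m"
    if "t \<noteq> 0" "absv t < 1" for t :: 'c and l m
    using legendre_min_ord_at_iff[OF that, of "eval_coeffs t A"] by simp
  have ord_le: "?T i \<le> ?t t i" if "t \<noteq> 0" "absv t < 1" for t :: 'c and i
    by (rule ord_T_le_ord_at[OF A that(2,1)])
  show ?thesis
  proof
    assume "stable_series R A"
    then have ent: "superlinear ?T"
      and np: "\<And>t. t \<noteq> 0 \<Longrightarrow> absv t < 1 \<Longrightarrow> newton_polygon (?t t) = newton_polygon ?T"
      unfolding stable_series_def T_adic_entire_iff_superlinear by auto
    have "\<exists>m. legendre_min ?T l m" for l
      using ent by (intro legendre_min_exists) (auto simp: A0 ord_T_def)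
    then obtain \<phi> where \<phi>: "\<And>l. legendre_min ?T l (\<phi> l)"
      by metis
    have "gauss_max (eval_coeffs t A) (absv t powr l) (absv t powr \<phi> l)"
      if t: "t \<noteq> 0" "absv t < 1" for t :: 'c and l
    proof -
      have "superlinear (?t t)"
        unfolding superlinear_def
      proof
        fix c
        show "\<forall>\<^sub>F i in sequentially. ereal (c * real i) \<le> ?t t i"
          using ent[unfolded superlinear_def, rule_format, of c]
          by eventually_elim (use ord_le[OF t] order_trans in blast)
      qed
      moreover have "?t t 0 = 0"
        using eval_at_of_nat[OF t(2), of 1] by (simp add: A0 ord_at_def)
      moreover have "?t t i \<noteq> -\<infinity>" for i
        by (simp add: ord_at_def)
      ultimately obtain m where m: "legendre_min (?t t) l m"
        using legendre_min_exists by blast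
      then have "m = \<phi> l"
        by (rule legendre_min_unique_if_newton_polygon_eq[OF np[OF t] _ \<phi>])
      with m show ?thesis
        by (simp add: gauss[OF t])
    qed
    with True show "A \<in> one_plus_s_series R \<and> (\<exists>\<phi>. \<forall>t l. t \<noteq> 0 \<longrightarrow> absv t < 1 \<longrightarrow>
        gauss_max (eval_coeffs t A) (absv t powr l) (absv t powr \<phi> l))"
      by blast
  next
    assume "A \<in> one_plus_s_series R \<and> (\<exists>\<phi>. \<forall>t l. t \<noteq> 0 \<longrightarrow> absv t < 1 \<longrightarrow>
        gauss_max (eval_coeffs t A) (absv t powr l) (absv t powr \<phi> l))"
    then obtain \<phi> where \<phi>: "\<And>t l. t \<noteq> 0 \<Longrightarrow> absv t < 1 \<Longrightarrow> legendre_min (?t t) l (\<phi> l)"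
      using gauss by blast
    have lower: "ereal (\<phi> l - l * real i) \<le> ?T i" for l i
    proof (rule le_ord_T_if_le_ord_at[OF A])
      fix t :: 'c assume t: "t \<noteq> 0" "absv t < 1"
      have "ereal (\<phi> l) \<le> ?t t i + ereal (l * real i)"
        using \<phi>[OF t, of l] by (simp add: legendre_min_def)
      then show "ereal (\<phi> l - l * real i) \<le> ?t t i"
        by (cases "?t t i") auto
    qed
    have T: "legendre_min ?T l (\<phi> l)" for l
    proof -
      define t where "t = (of_nat p :: 'c)"
      have t: "t \<noteq> 0" "absv t < 1"
        using absv_p_power[of 1] prime_gt_1_nat[OF prime_p] by (auto simp: t_def)
      obtain i where i: "?t t i + ereal (l * real i) = ereal (\<phi> l)"
        using \<phi>[OF t, of l] by (auto simp: legendre_min_def)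
      have *: "ereal (\<phi> l) \<le> ?T k + ereal (l * real k)" for k
        using lower[of l k] by (cases "?T k") auto
      moreover have "?T i + ereal (l * real i) \<le> ereal (\<phi> l)"
        unfolding i[symmetric] by (intro add_right_mono ord_le t)
      ultimately show ?thesis
        unfolding legendre_min_def by (intro conjI allI exI[of _ i] antisym)
    qed
    have "superlinear ?T"
      unfolding superlinear_def
    proof
      fix c
      \<comment> \<open>The line of slope \<open>c + 1\<close> with intercept \<open>\<phi> (- c - 1)\<close> overtakes the line of slope c through the origin.\<close>
      have "\<forall>\<^sub>F i in sequentially. - \<phi> (- c - 1) \<le> real i"
        by real_asymp
      then show "\<forall>\<^sub>F i in sequentially. ereal (c * real i) \<le> ?T i"
      proof eventually_elim
        case (elim i)
        then have "ereal (c * real i) \<le> ereal (\<phi> (- c - 1) - (- c - 1) * real i)"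
          by (simp add: algebra_simps)
        also have "\<dots> \<le> ?T i"
          by (rule lower)
        finally show ?case .
      qed
    qed
    then show "stable_series R A"
      unfolding stable_series_def T_adic_entire_iff_superlinear
      using True newton_polygon_eq_if_legendre_min_eq[OF \<phi> T] by blast
  qed
qed (simp add: stable_series_def)

end

section \<open>Slopes and their multiplicities\<close>

text \<open>
  The function \<open>\<Sum>i. min 0 (l + u\<^sub>i)\<close> is concave and piecewise linear, with a kink at
  \<open>l = - c\<close> whose size is the multiplicity of c among the \<open>u\<^sub>i\<close>. The
  multiplicity is therefore read off from a second difference around \<open>- c\<close>, with a step not
  exceeding the distance to all other kinks and to the boundary \<open>- \<Lambda>\<close>.
\<close>

lemma card_slopes_eq:
  fixes u :: "'i \<Rightarrow> real" and v :: "'j \<Rightarrow> real"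
  assumes "finite I" and "finite J"
    and eq: "\<And>l. l \<ge> - \<Lambda> \<Longrightarrow> (\<Sum>i\<in>I. min 0 (l + u i)) = (\<Sum>j\<in>J. min 0 (l + v j))"
    and "c < \<Lambda>"
  shows "card {i \<in> I. u i = c} = card {j \<in> J. v j = c}"
proof -
  define G where "G = insert (\<Lambda> - c)
    ((\<lambda>i. \<bar>u i - c\<bar>) ` {i \<in> I. u i \<noteq> c} \<union> (\<lambda>j. \<bar>v j - c\<bar>) ` {j \<in> J. v j \<noteq> c})"
  define \<epsilon> where "\<epsilon> = Min G"
  have fin: "finite G" and ne: "G \<noteq> {}"
    using assms(1,2) by (auto simp: G_def)
  have \<epsilon>: "\<epsilon> > 0"
    unfolding \<epsilon>_def using \<open>c < \<Lambda>\<close> by (subst Min_gr_iff[OF fin ne]) (auto simp: G_def)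
  have \<epsilon>le: "\<epsilon> \<le> x" if "x \<in> G" for x
    unfolding \<epsilon>_def using fin that by (rule Min_le)
  have \<epsilon>\<Lambda>: "\<epsilon> \<le> \<Lambda> - c"
    by (intro \<epsilon>le) (simp add: G_def)
  have kink: "(\<Sum>i\<in>K. min 0 (- c + \<epsilon> + w i)) + (\<Sum>i\<in>K. min 0 (- c - \<epsilon> + w i))
      - 2 * (\<Sum>i\<in>K. min 0 (- c + w i)) = - \<epsilon> * real (card {i \<in> K. w i = c})"
    if "finite K" and away: "\<And>i. i \<in> K \<Longrightarrow> w i \<noteq> c \<Longrightarrow> \<epsilon> \<le> \<bar>w i - c\<bar>"
    for K :: "'k set" and w
  proof -
    have "(\<Sum>i\<in>K. min 0 (- c + \<epsilon> + w i)) + (\<Sum>i\<in>K. min 0 (- c - \<epsilon> + w i))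
        - 2 * (\<Sum>i\<in>K. min 0 (- c + w i))
        = (\<Sum>i\<in>K. min 0 (- c + \<epsilon> + w i) + min 0 (- c - \<epsilon> + w i) - 2 * min 0 (- c + w i))"
      by (simp add: sum.distrib sum_subtractf sum_distrib_left)
    also have "\<dots> = (\<Sum>i\<in>K. if w i = c then - \<epsilon> else 0)"
    proof (rule sum.cong)
      fix i assume "i \<in> K"
      then show "min 0 (- c + \<epsilon> + w i) + min 0 (- c - \<epsilon> + w i) - 2 * min 0 (- c + w i)
          = (if w i = c then - \<epsilon> else 0)"
        using \<epsilon> away[of i] by (cases "w i = c") (auto simp: min_def abs_if split: if_splits)
    qed simp
    also have "\<dots> = - \<epsilon> * real (card {i \<in> K. w i = c})"
      using that(1) by (simp add: sum.If_cases Int_def)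
    finally show ?thesis .
  qed
  have "- \<epsilon> * real (card {i \<in> I. u i = c}) = - \<epsilon> * real (card {j \<in> J. v j = c})"
    using eq[of "- c + \<epsilon>"] eq[of "- c - \<epsilon>"] eq[of "- c"] \<epsilon> \<epsilon>\<Lambda>
    by (subst (1 2) kink[symmetric]) (auto intro!: \<epsilon>le assms(1,2) simp: G_def)
  then show ?thesis
    using \<epsilon> by simp
qed

lemma sum_over_slopes_eq:
  fixes u :: "'i \<Rightarrow> real" and v :: "'j \<Rightarrow> real" and g :: "real \<Rightarrow> real"
  assumes "finite I" and "finite J"
    and "\<And>l. l \<ge> - \<Lambda> \<Longrightarrow> (\<Sum>i\<in>I. min 0 (l + u i)) = (\<Sum>j\<in>J. min 0 (l + v j))"
    and "\<And>x. x \<ge> \<Lambda> \<Longrightarrow> g x = 0"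
  shows "(\<Sum>i\<in>I. g (u i)) = (\<Sum>j\<in>J. g (v j))"
proof -
  let ?W = "u ` I \<union> v ` J"
  have "(\<Sum>i\<in>I. g (u i)) = (\<Sum>c\<in>?W. of_nat (card {i \<in> I. u i = c}) * g c)"
    using assms(1,2) by (intro sum_fun_comp) auto
  also have "\<dots> = (\<Sum>c\<in>?W. of_nat (card {j \<in> J. v j = c}) * g c)"
  proof (rule sum.cong)
    fix c
    show "real (card {i \<in> I. u i = c}) * g c = real (card {j \<in> J. v j = c}) * g c"
      using card_slopes_eq[OF assms(1-3), of \<Lambda> c] assms(4)[of c] by (cases "c < \<Lambda>") auto
  qed simp
  also have "\<dots> = (\<Sum>j\<in>J. g (v j))"
    using assms(1,2) by (intro sum_fun_comp[symmetric]) auto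
  finally show ?thesis .
qed

lemma sum_min_le_member:
  fixes u :: "'i \<Rightarrow> real"
  assumes "finite I" and "i \<in> I"
  shows "(\<Sum>i\<in>I. min 0 (u i)) \<le> u i"
proof -
  have "(\<Sum>i\<in>I. min 0 (u i)) = min 0 (u i) + (\<Sum>i\<in>I - {i}. min 0 (u i))"
    using assms by (rule sum.remove)
  moreover have "(\<Sum>i\<in>I - {i}. min 0 (u i)) \<le> 0"
    by (intro sum_nonpos) simp
  ultimately show ?thesis
    by simp
qed

text \<open>
  The sums over pairs depend only on the transforms of u and v on \<open>[-\<Lambda>, \<infinity>)\<close>:
  the slopes u can be exchanged for u' and then v for v', since slopes that are at least
  \<open>\<Lambda>\<close> contribute 0 when paired with any slope of the other family. The value of the
  transform at 0 is a lower bound for the slopes.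
\<close>

lemma sum_slope_sums_eq:
  fixes u :: "'i \<Rightarrow> real" and u' :: "'k \<Rightarrow> real" and v :: "'j \<Rightarrow> real" and v' :: "'m \<Rightarrow> real"
  assumes fin: "finite I" "finite I'" "finite J" "finite J'"
    and u: "\<And>l. l \<ge> - \<Lambda> \<Longrightarrow> (\<Sum>i\<in>I. min 0 (l + u i)) = (\<Sum>i\<in>I'. min 0 (l + u' i))"
    and v: "\<And>l. l \<ge> - \<Lambda> \<Longrightarrow> (\<Sum>j\<in>J. min 0 (l + v j)) = (\<Sum>j\<in>J'. min 0 (l + v' j))"
    and "\<Lambda> \<ge> 0" and "\<Lambda> \<ge> - l - (\<Sum>i\<in>I. min 0 (u i))" and "\<Lambda> \<ge> - l - (\<Sum>j\<in>J. min 0 (v j))"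
  shows "(\<Sum>i\<in>I. \<Sum>j\<in>J. min 0 (l + u i + v j)) = (\<Sum>i\<in>I'. \<Sum>j\<in>J'. min 0 (l + u' i + v' j))"
proof -
  have "(\<Sum>i\<in>I. \<Sum>j\<in>J. min 0 (l + u i + v j)) = (\<Sum>i\<in>I'. \<Sum>j\<in>J. min 0 (l + u' i + v j))"
  proof (rule sum_over_slopes_eq[OF fin(1,2) u])
    fix x assume "x \<ge> \<Lambda>"
    then have "l + x + v j \<ge> 0" if "j \<in> J" for j
      using sum_min_le_member[OF fin(3) that, of v] assms(9) by linarith
    then show "(\<Sum>j\<in>J. min 0 (l + x + v j)) = 0"
      by (intro sum.neutral) auto
  qed
  also have "\<dots> = (\<Sum>j\<in>J. \<Sum>i\<in>I'. min 0 (l + u' i + v j))"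
    by (rule sum.swap)
  also have "\<dots> = (\<Sum>j\<in>J'. \<Sum>i\<in>I'. min 0 (l + u' i + v' j))"
  proof (rule sum_over_slopes_eq[OF fin(3,4) v])
    fix y assume "y \<ge> \<Lambda>"
    then have "l + u' i + y \<ge> 0" if "i \<in> I'" for i
      using sum_min_le_member[OF fin(2) that, of u'] assms(8) u[of 0] \<open>\<Lambda> \<ge> 0\<close> by simp
    then show "(\<Sum>i\<in>I'. min 0 (l + u' i + y)) = 0"
      by (intro sum.neutral) auto
  qed
  also have "\<dots> = (\<Sum>i\<in>I'. \<Sum>j\<in>J'. min 0 (l + u' i + v' j))"
    by (rule sum.swap)
  finally show ?thesis .
qed

section \<open>Gauss norms of products and tensor products\<close>

context padic_complex_field
begin

lemma gauss_max_unique: "gauss_max A r D \<Longrightarrow> gauss_max A r E \<Longrightarrow> D = E"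
  unfolding gauss_max_def by (metis order_antisym)

lemma gauss_max_ge_1: "gauss_max A r D \<Longrightarrow> fps_nth A 0 = 1 \<Longrightarrow> 1 \<le> D"
  unfolding gauss_max_def by (metis absv_one mult.right_neutral power_0)

text \<open>
  Gauss's lemma. With i and j the least indices where A and B attain their norms, the product of these two
  coefficients strictly dominates all other contributions to the coefficient of degree \<open>i + j\<close>.
\<close>

lemma gauss_max_mult:
  assumes A: "gauss_max A r D" and B: "gauss_max B r E" and "r > 0" "D > 0" "E > 0"
  shows "gauss_max (A * B) r (D * E)"
proof -
  let ?a = "\<lambda>i. absv (fps_nth A i) * r ^ i" and ?b = "\<lambda>i. absv (fps_nth B i) * r ^ i"
  have a_le: "?a i \<le> D" and b_le: "?b i \<le> E" for i
    using A B by (auto simp: gauss_max_def)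
  have coeff_term: "absv (fps_nth A i * fps_nth B (n - i)) * r ^ n = ?a i * ?b (n - i)" if "i \<le> n" for i n
  proof -
    have "r ^ n = r ^ i * r ^ (n - i)"
      using that by (simp flip: power_add)
    then show ?thesis
      by (simp add: absv_mult)
  qed
  have "absv (fps_nth (A * B) n) * r ^ n \<le> D * E" for n
  proof -
    have "absv (fps_nth (A * B) n) \<le> D * E / r ^ n"
      unfolding fps_mult_nth
    proof (rule absv_sum_le)
      fix i assume "i \<in> {0..n}"
      then have "absv (fps_nth A i * fps_nth B (n - i)) * r ^ n \<le> D * E"
        using coeff_term[of i n] a_le[of i] b_le[of "n - i"] assms by (auto intro!: mult_mono)
      then show "absv (fps_nth A i * fps_nth B (n - i)) \<le> D * E / r ^ n"
        using \<open>r > 0\<close> by (simp add: pos_le_divide_eq)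
    qed (use assms in simp)
    then show ?thesis
      using \<open>r > 0\<close> by (simp add: pos_le_divide_eq)
  qed
  moreover have "\<exists>n. absv (fps_nth (A * B) n) * r ^ n = D * E"
  proof -
    define i where "i = (LEAST i. ?a i = D)"
    define j where "j = (LEAST j. ?b j = E)"
    have i: "?a i = D" and j: "?b j = E"
      unfolding i_def j_def using A B by (auto simp: gauss_max_def intro: LeastI_ex)
    have a_less: "?a k < D" if "k < i" for k
      using not_less_Least[of k "\<lambda>i. ?a i = D"] that a_le[of k] by (auto simp: i_def)
    have b_less: "?b k < E" if "k < j" for k
      using not_less_Least[of k "\<lambda>j. ?b j = E"] that b_le[of k] by (auto simp: j_def)
    let ?t = "\<lambda>k. fps_nth A k * fps_nth B (i + j - k)"
    have main: "absv (?t i) * r ^ (i + j) = D * E"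
      using coeff_term[of i "i + j"] i j by simp
    have "fps_nth (A * B) (i + j) = ?t i + (\<Sum>k\<in>{0..i + j} - {i}. ?t k)"
      unfolding fps_mult_nth by (intro sum.remove) auto
    moreover have "absv (\<Sum>k\<in>{0..i + j} - {i}. ?t k) < absv (?t i)"
    proof (rule absv_sum_less)
      fix k assume k: "k \<in> {0..i + j} - {i}"
      have "?a k * ?b (i + j - k) < D * E"
      proof (cases "k < i")
        case True
        then show ?thesis
          using a_less[of k] b_le[of "i + j - k"] assms
          by (intro le_less_trans[OF mult_left_mono mult_strict_right_mono]) auto
      next
        case False
        then have "i + j - k < j"
          using k by auto
        then show ?thesis
          using a_le[of k] b_less[of "i + j - k"] assms
          by (intro le_less_trans[OF mult_right_mono mult_strict_left_mono]) auto
      qed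
      then have "absv (?t k) * r ^ (i + j) < absv (?t i) * r ^ (i + j)"
        unfolding main using coeff_term[of k "i + j"] k by simp
      then show "absv (?t k) < absv (?t i)"
        using \<open>r > 0\<close> by simp
    next
      have "absv (?t i) * r ^ (i + j) > 0"
        unfolding main using assms by simp
      then show "absv (?t i) > 0"
        using \<open>r > 0\<close> by (simp add: zero_less_mult_iff)
    qed
    ultimately have "absv (fps_nth (A * B) (i + j)) = absv (?t i)"
      using absv_add_eq by simp
    then show ?thesis
      using main by metis
  qed
  ultimately show ?thesis
    by (simp add: gauss_max_def)
qed

lemma gauss_max_linear:
  assumes "r > 0"
  shows "gauss_max (1 - fps_const \<alpha> * fps_X) r (max 1 (absv \<alpha> * r))"
proof -
  have nth: "fps_nth (1 - fps_const \<alpha> * fps_X) n = (if n = 0 then 1 else if n = 1 then - \<alpha> else 0)" for n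
    by (simp add: fps_X_def)
  have "absv (fps_nth (1 - fps_const \<alpha> * fps_X) n) * r ^ n \<le> max 1 (absv \<alpha> * r)" for n
    unfolding nth using assms by auto
  moreover have "\<exists>n. absv (fps_nth (1 - fps_const \<alpha> * fps_X) n) * r ^ n = max 1 (absv \<alpha> * r)"
      by (rule exI[of _ "if absv \<alpha> * r \<le> 1 then 0 else 1"]) (simp add: nth del: fps_sub_nth)
  ultimately show ?thesis
    unfolding gauss_max_def by blast
qed

lemma gauss_max_prod_linear:
  assumes "finite I" and "\<And>i. i \<in> I \<Longrightarrow> \<alpha> i \<noteq> 0" and \<theta>: "0 < \<theta>" "\<theta> < 1"
  shows "gauss_max (\<Prod>i\<in>I. 1 - fps_const (\<alpha> i) * fps_X) (\<theta> powr l)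
    (\<theta> powr (\<Sum>i\<in>I. min 0 (l + ln (absv (\<alpha> i)) / ln \<theta>)))"
  using assms(1,2)
proof (induction I rule: finite_induct)
  case empty
  show ?case
    using \<theta> by (auto simp: gauss_max_def intro: exI[of _ 0])
next
  case (insert i I)
  have "absv (\<alpha> i) = \<theta> powr (ln (absv (\<alpha> i)) / ln \<theta>)"
    using insert.prems \<theta> by (simp add: powr_def)
  then have "absv (\<alpha> i) * \<theta> powr l = \<theta> powr (l + ln (absv (\<alpha> i)) / ln \<theta>)"
    by (simp add: powr_add)
  moreover have "max 1 (\<theta> powr x) = \<theta> powr (min 0 x)" for x
    using powr_le_powr_iff_base_less_one[OF \<theta>, of 0 x] \<theta> by (auto simp: max_def min_def)
  ultimately have "gauss_max (1 - fps_const (\<alpha> i) * fps_X) (\<theta> powr l)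
      (\<theta> powr (min 0 (l + ln (absv (\<alpha> i)) / ln \<theta>)))"
    using gauss_max_linear[of "\<theta> powr l" "\<alpha> i"] \<theta> by simp
  then show ?case
    using gauss_max_mult[OF _ insert.IH] insert \<theta> by (simp add: powr_add)
qed

text \<open>
  A series with constant term 1 whose Gauss norm exists beyond r0 is the coefficientwise limit of split
  polynomials that have the same Gauss norms at all radii up to r0. Beyond an index N the terms of A are at
  most 1 at radius r0, so they do not contribute to the norm, which is at least 1; the others are replaced by
  algebraic numbers of the same absolute value.
\<close>

lemma split_approximation:
  assumes "fps_nth A 0 = 1" and "r0 > 0" and "gauss_max A (2 * r0) E"
  obtains P and d :: "nat \<Rightarrow> nat" and \<alpha>
  where "\<And>m. P m = (\<Prod>i<d m. 1 - fps_const (\<alpha> m i) * fps_X)"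
    and "\<And>m i. \<alpha> m i \<noteq> (0 :: 'c)"
    and "\<And>i. (\<lambda>m. fps_nth (P m) i) \<longlonglongrightarrow> fps_nth A i"
    and "\<And>m r D. 0 < r \<Longrightarrow> r \<le> r0 \<Longrightarrow> gauss_max A r D \<Longrightarrow> gauss_max (P m) r D"
proof -
  have "(\<lambda>i. E * (1 / 2) ^ i) \<longlonglongrightarrow> E * 0"
    by (intro tendsto_mult tendsto_const LIMSEQ_power_zero) simp
  then have "\<forall>\<^sub>F i in sequentially. E * (1 / 2) ^ i < 1"
    by (rule order_tendstoD) simp
  then obtain N where N: "\<And>i. i \<ge> N \<Longrightarrow> E * (1 / 2) ^ i < 1"
    by (auto simp: eventually_sequentially)
  have tail: "absv (fps_nth A i) * r ^ i \<le> 1" if "i \<ge> N" "0 < r" "r \<le> r0" for i r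
  proof -
    have "absv (fps_nth A i) * r ^ i \<le> absv (fps_nth A i) * r0 ^ i"
      using that by (intro mult_left_mono power_mono) auto
    also have "\<dots> = absv (fps_nth A i) * (2 * r0) ^ i * (1 / 2) ^ i"
      by (simp add: power_mult_distrib power_divide)
    also have "\<dots> \<le> E * (1 / 2) ^ i"
      using assms(3) by (intro mult_right_mono) (auto simp: gauss_max_def)
    also have "\<dots> \<le> 1"
      using N[OF that(1)] by simp
    finally show ?thesis .
  qed
  define good where "good = (\<lambda>m P (d :: nat) \<alpha>. P = (\<Prod>i<d. 1 - fps_const (\<alpha> i) * fps_X) \<and>
    (\<forall>i. \<alpha> i \<noteq> (0 :: 'c)) \<and>
    (\<forall>i\<le>N + m. absv (fps_nth P i - fps_nth A i) < 1 / real (Suc m)) \<and>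
    (\<forall>r D. 0 < r \<longrightarrow> r \<le> r0 \<longrightarrow> gauss_max A r D \<longrightarrow> gauss_max P r D))"
  have "\<exists>P d \<alpha>. good m P d \<alpha>" for m
  proof -
    have "\<exists>y \<in> padic_algebraic. absv (y - fps_nth A i) < 1 / real (Suc m) \<and>
        absv y = absv (fps_nth A i) \<and> (fps_nth A i = 1 \<longrightarrow> y = 1)" for i
      by (rule padic_algebraic_approx) simp
    then obtain y where y: "\<And>i. y i \<in> padic_algebraic"
        "\<And>i. absv (y i - fps_nth A i) < 1 / real (Suc m)"
        "\<And>i. absv (y i) = absv (fps_nth A i)" "\<And>i. fps_nth A i = 1 \<Longrightarrow> y i = 1"
      by metis
    define f where "f = (\<Sum>i\<le>N + m. Polynomial.monom (y i) i)"
    have coeff_f: "Polynomial.coeff f i = (if i \<le> N + m then y i else 0)" for i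
      by (simp add: f_def coeff_sum)
    obtain \<alpha> where \<alpha>: "\<And>i. \<alpha> i \<noteq> 0" "f = (\<Prod>i<Polynomial.degree f. [:1, - \<alpha> i:])"
    proof -
      have "Polynomial.coeff f i \<in> padic_algebraic" for i
        using y(1) padic_algebraic_closed(2) by (simp add: coeff_f)
      moreover have "Polynomial.coeff f 0 = 1"
        using y(4) assms(1) by (simp add: coeff_f)
      ultimately show ?thesis
        using padic_algebraic_split[of f] that by blast
    qed
    define P where "P = fps_of_poly f"
    have nth: "fps_nth P i = (if i \<le> N + m then y i else 0)" for i
      by (simp add: P_def coeff_f)
    have lin: "fps_of_poly [:1, - c:] = 1 - fps_const c * fps_X" for c :: 'c
      by (simp add: fps_of_poly_pCons fps_const_neg[symmetric] del: fps_const_neg)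
    have "P = (\<Prod>i<Polynomial.degree f. fps_of_poly [:1, - \<alpha> i:])"
      unfolding P_def by (subst \<alpha>(2)) (simp add: fps_of_poly_prod)
    then have P: "P = (\<Prod>i<Polynomial.degree f. 1 - fps_const (\<alpha> i) * fps_X)"
      by (simp only: lin)
    have "gauss_max P r D" if r: "0 < r" "r \<le> r0" and D: "gauss_max A r D" for r D
    proof -
      have "1 \<le> D"
        using gauss_max_ge_1[OF D assms(1)] .
      obtain n where n: "absv (fps_nth A n) * r ^ n = D"
        using D by (auto simp: gauss_max_def)
      have "\<exists>n. absv (fps_nth P n) * r ^ n = D"
      proof (cases "n \<le> N + m")
        case True
        then show ?thesis
          using n by (intro exI[of _ n]) (simp add: nth y(3))
      next
        case False
        then have "D = 1"
          using tail[of n r] r n \<open>1 \<le> D\<close> by simp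
        then show ?thesis
          using assms(1) by (intro exI[of _ 0]) (simp add: nth y(4))
      qed
      moreover have "absv (fps_nth P i) * r ^ i \<le> D" for i
        using D \<open>1 \<le> D\<close> by (simp add: nth y(3) gauss_max_def)
      ultimately show ?thesis
        by (simp add: gauss_max_def)
    qed
    moreover have "\<forall>i\<le>N + m. absv (fps_nth P i - fps_nth A i) < 1 / real (Suc m)"
      using y(2) by (simp add: nth)
    ultimately show ?thesis
      unfolding good_def using P \<alpha>(1) by blast
  qed
  then obtain P d \<alpha> where "\<And>m. good m (P m) (d m) (\<alpha> m)"
    by metis
  then have P: "\<And>m. P m = (\<Prod>i<d m. 1 - fps_const (\<alpha> m i) * fps_X)"
      "\<And>m i. \<alpha> m i \<noteq> 0"
      "\<And>m i. i \<le> N + m \<Longrightarrow> absv (fps_nth (P m) i - fps_nth A i) < 1 / real (Suc m)"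
      "\<And>m r D. 0 < r \<Longrightarrow> r \<le> r0 \<Longrightarrow> gauss_max A r D \<Longrightarrow> gauss_max (P m) r D"
    unfolding good_def by blast+
  have "(\<lambda>m. fps_nth (P m) i) \<longlonglongrightarrow> fps_nth A i" for i
  proof -
    have le: "\<forall>\<^sub>F m in sequentially. absv (fps_nth (P m) i - fps_nth A i) \<le> 1 / real (Suc m)"
      using eventually_ge_at_top[of i]
    proof eventually_elim
      case (elim m)
      show ?case
        using P(3)[of i m] elim by (simp only: less_imp_le trans_le_add2)
    qed
    have "(\<lambda>m. 1 / real (Suc m)) \<longlonglongrightarrow> 0"
      using LIMSEQ_inverse_real_of_nat by (simp only: inverse_eq_divide)
    then have "(\<lambda>m. absv (fps_nth (P m) i - fps_nth A i)) \<longlonglongrightarrow> 0"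
      by (intro tendsto_sandwich[OF _ le tendsto_const] always_eventually allI absv_nonneg)
    then show ?thesis
      by (rule tendsto_iff_absv[THEN iffD2])
  qed
  note lim = this
  show ?thesis
    by (rule that[of P \<alpha> d, OF P(1,2) lim P(4)])
qed

text \<open>
  By Newton's identities each power sum is a polynomial in finitely many coefficients.
\<close>

lemma tendsto_power_sums:
  assumes "\<And>m. power_sums (P m) (a m)" and "power_sums A a'"
    and "\<And>i. (\<lambda>m. fps_nth (P m) i) \<longlonglongrightarrow> (fps_nth A i :: 'c)" and "k > 0"
  shows "(\<lambda>m. a m k) \<longlonglongrightarrow> a' k"
  using assms(4)
proof (induction k rule: less_induct)
  case (less k)
  then obtain n where n: "k = Suc n"
    by (cases k) auto
  have "(\<lambda>m. - (of_nat (Suc n) * fps_nth (P m) (Suc n))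
      + - (\<Sum>i<n. fps_nth (P m) (Suc i) * a m (n - i)))
    \<longlonglongrightarrow> - (of_nat (Suc n) * fps_nth A (Suc n)) + - (\<Sum>i<n. fps_nth A (Suc i) * a' (n - i))"
    using less.IH n
    by (intro tendsto_add_padic tendsto_minus_padic tendsto_mult_padic tendsto_sum_padic
        tendsto_const assms(3)) auto
  then show ?case
    unfolding n power_sums_Suc[OF assms(1)] power_sums_Suc[OF assms(2)] by simp
qed

text \<open>
  By Newton's identities each coefficient is a polynomial with rational coefficients in finitely many power
  sums.
\<close>

lemma tendsto_coeffs:
  assumes "\<And>m. power_sums (P m) (a m)" and "power_sums A a'"
    and "\<And>k. k > 0 \<Longrightarrow> (\<lambda>m. a m k) \<longlonglongrightarrow> a' k"
  shows "(\<lambda>m. fps_nth (P m) i) \<longlonglongrightarrow> (fps_nth A i :: 'c)"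
proof (induction i rule: less_induct)
  case (less i)
  show ?case
  proof (cases i)
    case 0
    then show ?thesis
      using assms(1,2) by (simp add: power_sums_def)
  next
    case (Suc n)
    have rec: "fps_nth Q (Suc n) = inverse (of_nat (Suc n)) * - (\<Sum>i\<le>n. fps_nth Q i * q (Suc (n - i)))"
      if "power_sums Q q" for Q :: "'c fps" and q
      using newton_identity[OF that, of n] by (simp add: field_simps add_eq_0_iff del: of_nat_Suc)
    have "(\<lambda>m. inverse (of_nat (Suc n)) * - (\<Sum>i\<le>n. fps_nth (P m) i * a m (Suc (n - i))))
        \<longlonglongrightarrow> inverse (of_nat (Suc n)) * - (\<Sum>i\<le>n. fps_nth A i * a' (Suc (n - i)))"
      using less.IH Suc
      by (intro tendsto_minus_padic tendsto_mult_padic tendsto_sum_padic tendsto_const assms(3)) auto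
    then show ?thesis
      unfolding Suc rec[OF assms(1)] rec[OF assms(2)] .
  qed
qed

text \<open>
  The approximations of A, with the Gauss norm expressed by the valuations of the reciprocal roots.
\<close>

lemma split_approximation_slopes:
  assumes "fps_nth A 0 = 1" and \<theta>: "0 < \<theta>" "\<theta> < 1"
    and "\<And>l. gauss_max A (\<theta> powr l) (\<theta> powr \<phi> l)"
  obtains P and d :: "nat \<Rightarrow> nat" and \<alpha>
  where "\<And>m. P m = (\<Prod>i<d m. 1 - fps_const (\<alpha> m i) * fps_X)"
    and "\<And>m i. \<alpha> m i \<noteq> (0 :: 'c)"
    and "\<And>i. (\<lambda>m. fps_nth (P m) i) \<longlonglongrightarrow> fps_nth A i"
    and "\<And>m l. l \<ge> - \<Lambda> \<Longrightarrow> (\<Sum>i<d m. min 0 (l + ln (absv (\<alpha> m i)) / ln \<theta>)) = \<phi> l"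
proof -
  \<comment> \<open>Twice the largest radius of interest is again a power of \<open>\<theta>\<close>.\<close>
  have "2 * \<theta> powr (- \<Lambda>) = \<theta> powr (ln 2 / ln \<theta> - \<Lambda>)"
    using \<theta> by (simp add: powr_def exp_add[symmetric] algebra_simps exp_diff exp_minus inverse_eq_divide)
  then have E: "gauss_max A (2 * \<theta> powr (- \<Lambda>)) (\<theta> powr \<phi> (ln 2 / ln \<theta> - \<Lambda>))"
    using assms(4) by simp
  have r0: "\<theta> powr (- \<Lambda>) > 0"
    using \<theta> by simp
  obtain P d \<alpha> where P: "\<And>m. P m = (\<Prod>i<(d m :: nat). 1 - fps_const (\<alpha> m i) * fps_X)"
      "\<And>m i. \<alpha> m i \<noteq> (0 :: 'c)" "\<And>i. (\<lambda>m. fps_nth (P m) i) \<longlonglongrightarrow> fps_nth A i"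
      "\<And>m r D. 0 < r \<Longrightarrow> r \<le> \<theta> powr (- \<Lambda>) \<Longrightarrow> gauss_max A r D \<Longrightarrow> gauss_max (P m) r D"
    by (rule split_approximation[OF assms(1) r0 E]) (rule that)
  have "(\<Sum>i<d m. min 0 (l + ln (absv (\<alpha> m i)) / ln \<theta>)) = \<phi> l" if "l \<ge> - \<Lambda>" for m l
  proof -
    have "gauss_max (P m) (\<theta> powr l) (\<theta> powr \<phi> l)"
      using that \<theta> by (intro P(4) assms(4)) (auto simp: powr_le_powr_iff_base_less_one)
    moreover have "gauss_max (P m) (\<theta> powr l)
        (\<theta> powr (\<Sum>i<d m. min 0 (l + ln (absv (\<alpha> m i)) / ln \<theta>)))"
      unfolding P(1) using P(2) \<theta> by (intro gauss_max_prod_linear) auto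
    ultimately have "\<theta> powr \<phi> l = \<theta> powr (\<Sum>i<d m. min 0 (l + ln (absv (\<alpha> m i)) / ln \<theta>))"
      by (rule gauss_max_unique)
    then show ?thesis
      using \<theta> by (simp add: order_eq_iff powr_le_powr_iff_base_less_one)
  qed
  note slopes = this
  show ?thesis
    by (rule that[of P \<alpha> d, OF P(1-3) slopes])
qed

text \<open>
  The Gauss norm of the tensor product, computed from any two finite families of slopes whose transforms agree
  with those of A and B on \<open>[-\<Lambda>, \<infinity>)\<close>. For split polynomials this is the
  multiplicativity of the Gauss norm together with the fact that only the transforms matter. The
  approximations of A and B make the tensor products converge coefficientwise; their common Gauss norm passes
  to the limit because the index where it is attained stays bounded.
\<close>

lemma gauss_max_tensor:
  fixes du dv :: nat
  assumes a: "power_sums A a" and b: "power_sums B b" and c: "power_sums C (\<lambda>k. a k * b k)"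
    and \<theta>: "0 < \<theta>" "\<theta> < 1"
    and A: "\<And>l. gauss_max A (\<theta> powr l) (\<theta> powr \<phi> l)"
    and B: "\<And>l. gauss_max B (\<theta> powr l) (\<theta> powr \<psi> l)"
    and u: "\<And>l. l \<ge> - \<Lambda> \<Longrightarrow> (\<Sum>i<du. min 0 (l + u i)) = \<phi> l"
    and v: "\<And>l. l \<ge> - \<Lambda> \<Longrightarrow> (\<Sum>j<dv. min 0 (l + v j)) = \<psi> l"
    and \<Lambda>: "\<Lambda> \<ge> 0" "\<Lambda> \<ge> 1 - l - \<phi> 0" "\<Lambda> \<ge> 1 - l - \<psi> 0"
  shows "gauss_max C (\<theta> powr l) (\<theta> powr (\<Sum>i<du. \<Sum>j<dv. min 0 (l + u i + v j)))"
proof -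
  have A0: "fps_nth A 0 = 1" and B0: "fps_nth B 0 = 1"
    using a b by (auto simp: power_sums_def)
  obtain P d \<alpha> where P: "\<And>m. P m = (\<Prod>i<(d m :: nat). 1 - fps_const (\<alpha> m i) * fps_X)"
      "\<And>m i. \<alpha> m i \<noteq> (0 :: 'c)" "\<And>i. (\<lambda>m. fps_nth (P m) i) \<longlonglongrightarrow> fps_nth A i"
      "\<And>m l. l \<ge> - \<Lambda> \<Longrightarrow> (\<Sum>i<d m. min 0 (l + ln (absv (\<alpha> m i)) / ln \<theta>)) = \<phi> l"
    by (rule split_approximation_slopes[OF A0 \<theta> A, of \<Lambda>]) (rule that)
  obtain Q e \<beta> where Q: "\<And>m. Q m = (\<Prod>i<(e m :: nat). 1 - fps_const (\<beta> m i) * fps_X)"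
      "\<And>m i. \<beta> m i \<noteq> (0 :: 'c)" "\<And>i. (\<lambda>m. fps_nth (Q m) i) \<longlonglongrightarrow> fps_nth B i"
      "\<And>m l. l \<ge> - \<Lambda> \<Longrightarrow> (\<Sum>i<e m. min 0 (l + ln (absv (\<beta> m i)) / ln \<theta>)) = \<psi> l"
    by (rule split_approximation_slopes[OF B0 \<theta> B, of \<Lambda>]) (rule that)
  define S where "S = (\<lambda>m. \<Prod>i<d m. \<Prod>j<e m. 1 - fps_const (\<alpha> m i * \<beta> m j) * fps_X)"
  define w where "w = (\<lambda>l. \<Sum>i<du. \<Sum>j<dv. min 0 (l + u i + v j))"
  have psP: "power_sums (P m) (\<lambda>k. \<Sum>i<d m. \<alpha> m i ^ k)" for m
    unfolding P(1) by (intro power_sums_prod power_sums_linear)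
  have psQ: "power_sums (Q m) (\<lambda>k. \<Sum>i<e m. \<beta> m i ^ k)" for m
    unfolding Q(1) by (intro power_sums_prod power_sums_linear)
  have psS: "power_sums (S m) (\<lambda>k. (\<Sum>i<d m. \<alpha> m i ^ k) * (\<Sum>j<e m. \<beta> m j ^ k))" for m
    unfolding S_def by (rule power_sums_tensor_linear)
  have lim: "(\<lambda>m. fps_nth (S m) n) \<longlonglongrightarrow> fps_nth C n" for n
    by (intro tendsto_coeffs[OF psS c] tendsto_mult_padic
        tendsto_power_sums[OF psP a P(3)] tendsto_power_sums[OF psQ b Q(3)])
  have S: "gauss_max (S m) (\<theta> powr l') (\<theta> powr w l')" if "l - 1 \<le> l'" for m l'
  proof -
    let ?f = "\<lambda>z. \<alpha> m (fst z) * \<beta> m (snd z)"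
    have "S m = (\<Prod>z\<in>{..<d m} \<times> {..<e m}. 1 - fps_const (?f z) * fps_X)"
      by (simp add: S_def prod.cartesian_product case_prod_beta)
    moreover have "gauss_max (\<Prod>z\<in>{..<d m} \<times> {..<e m}. 1 - fps_const (?f z) * fps_X) (\<theta> powr l')
        (\<theta> powr (\<Sum>z\<in>{..<d m} \<times> {..<e m}. min 0 (l' + ln (absv (?f z)) / ln \<theta>)))"
      using P(2) Q(2) \<theta> by (intro gauss_max_prod_linear) auto
    moreover have "(\<Sum>z\<in>{..<d m} \<times> {..<e m}. min 0 (l' + ln (absv (?f z)) / ln \<theta>))
        = (\<Sum>i<d m. \<Sum>j<e m. min 0 (l' + ln (absv (\<alpha> m i)) / ln \<theta> + ln (absv (\<beta> m j)) / ln \<theta>))"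
      using P(2) Q(2)
      by (simp add: sum.cartesian_product case_prod_beta absv_mult ln_mult add_divide_distrib add.assoc)
    moreover have "\<dots> = w l'"
      unfolding w_def
    proof (rule sum_slope_sums_eq[where \<Lambda> = \<Lambda>])
      show "- l' - (\<Sum>i<d m. min 0 (ln (absv (\<alpha> m i)) / ln \<theta>)) \<le> \<Lambda>"
        using P(4)[of 0 m] \<Lambda> that by simp
      show "- l' - (\<Sum>i<e m. min 0 (ln (absv (\<beta> m i)) / ln \<theta>)) \<le> \<Lambda>"
        using Q(4)[of 0 m] \<Lambda> that by simp
    qed (use P(4) Q(4) u v \<Lambda>(1) in simp_all)
    ultimately show ?thesis
      by simp
  qed
  let ?r = "\<theta> powr l" and ?D = "\<theta> powr w l"
  have limr: "(\<lambda>m. absv (fps_nth (S m) n) * ?r ^ n) \<longlonglongrightarrow> absv (fps_nth C n) * ?r ^ n" for n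
    by (intro tendsto_mult tendsto_absv lim tendsto_const)
  have le: "absv (fps_nth C n) * ?r ^ n \<le> ?D" for n
    using S[of l] by (intro LIMSEQ_le_const2[OF limr]) (auto simp: gauss_max_def)
  have "1 \<le> ?D"
    using gauss_max_ge_1[OF S[of l 0]] psS[of 0] by (simp add: power_sums_def)
  have "(\<lambda>n. \<theta> powr w (l - 1) * \<theta> ^ n) \<longlonglongrightarrow> \<theta> powr w (l - 1) * 0"
    using \<theta> by (intro tendsto_mult tendsto_const LIMSEQ_power_zero) simp
  then have "\<forall>\<^sub>F n in sequentially. \<theta> powr w (l - 1) * \<theta> ^ n < 1"
    by (rule order_tendstoD) simp
  then obtain N where N: "\<And>n. n \<ge> N \<Longrightarrow> \<theta> powr w (l - 1) * \<theta> ^ n < 1"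
    by (auto simp: eventually_sequentially)
  \<comment> \<open>At the larger radius \<open>\<theta> powr (l - 1)\<close> the norm is still bounded, which forces geometric decay at radius \<open>\<theta> powr l\<close>.\<close>
  have early: "n < N" if "absv (fps_nth (S m) n) * ?r ^ n = ?D" for m n
  proof (rule ccontr)
    assume "\<not> n < N"
    have "?r = \<theta> powr (l - 1) * \<theta>"
      using \<theta> by (simp add: powr_diff)
    then have "absv (fps_nth (S m) n) * ?r ^ n = (absv (fps_nth (S m) n) * (\<theta> powr (l - 1)) ^ n) * \<theta> ^ n"
      by (simp add: power_mult_distrib)
    also have "\<dots> \<le> \<theta> powr w (l - 1) * \<theta> ^ n"
      using S[of "l - 1" m] \<theta> by (intro mult_right_mono) (auto simp: gauss_max_def)
    also have "\<dots> < 1"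
      using N[of n] \<open>\<not> n < N\<close> by simp
    finally show False
      using that \<open>1 \<le> ?D\<close> by simp
  qed
  have "\<exists>n. absv (fps_nth C n) * ?r ^ n = ?D"
  proof (rule ccontr)
    assume "\<not> ?thesis"
    then have "absv (fps_nth C n) * ?r ^ n < ?D" for n
      using le[of n] by (metis less_eq_real_def)
    then have "\<forall>\<^sub>F m in sequentially. \<forall>n\<in>{..<N}. absv (fps_nth (S m) n) * ?r ^ n < ?D"
      by (intro eventually_ball_finite ballI order_tendstoD(2)[OF limr]) auto
    then obtain m where m: "\<And>n. n < N \<Longrightarrow> absv (fps_nth (S m) n) * ?r ^ n < ?D"
      by (auto simp: eventually_sequentially)
    obtain n where n: "absv (fps_nth (S m) n) * ?r ^ n = ?D"
      using S[of l m] by (auto simp: gauss_max_def)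
    then show False
      using m[OF early[OF n]] by simp
  qed
  then show ?thesis
    unfolding gauss_max_def using le by (simp add: w_def)
qed

end

section \<open>Stability of products and tensor products\<close>

context padic_complex_field
begin

text \<open>
  The exponents \<open>\<phi>\<close> add up.
\<close>

lemma stable_series_mult:
  fixes R :: "'c set"
  assumes R: "coefficient_subring R" "R \<subseteq> {x. absv x \<le> 1}"
    and A: "stable_series R A" and B: "stable_series R B"
  shows "stable_series R (A * B)"
proof -
  interpret coefficient_subring "fps_over (fps_over R)"
    by (intro coefficient_subring_fps_over R(1))
  note iff = stable_series_iff[OF R(2)[folded unit_ball_def]]
  obtain \<phi> where A1: "fps_nth A 0 = 1" "A \<in> fps_over (fps_over R)"
    and \<phi>: "\<And>t l. t \<noteq> 0 \<Longrightarrow> absv t < 1 \<Longrightarrow> gauss_max (eval_coeffs t A) (absv t powr l) (absv t powr \<phi> l)"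
    using A unfolding iff one_plus_s_series_iff by blast
  obtain \<psi> where B1: "fps_nth B 0 = 1" "B \<in> fps_over (fps_over R)"
    and \<psi>: "\<And>t l. t \<noteq> 0 \<Longrightarrow> absv t < 1 \<Longrightarrow> gauss_max (eval_coeffs t B) (absv t powr l) (absv t powr \<psi> l)"
    using B unfolding iff one_plus_s_series_iff by blast
  have ball: "A \<in> fps_over (fps_over unit_ball)" "B \<in> fps_over (fps_over unit_ball)"
    using A1(2) B1(2) fps_over_mono[OF fps_over_mono[OF R(2)[folded unit_ball_def]]] by auto
  have "gauss_max (eval_coeffs t (A * B)) (absv t powr l) (absv t powr (\<phi> l + \<psi> l))"
    if "t \<noteq> 0" "absv t < 1" for t l
    unfolding eval_coeffs_mult[OF ball that(2)] powr_add
    using that by (intro gauss_max_mult \<phi> \<psi>) auto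
  then show ?thesis
    unfolding iff one_plus_s_series_iff using A1 B1
    by (intro conjI exI[of _ "\<lambda>l. \<phi> l + \<psi> l"]) (auto intro: mult)
qed

text \<open>
  For each l the slope families are chosen once, at t = p. As the transforms of A(s,t) and B(s,t) are the same
  for all t, these families serve for every t, and so the exponent of the tensor product is independent of t.
\<close>

lemma stable_series_tensor:
  fixes R :: "'c set"
  assumes R: "coefficient_subring R" "R \<subseteq> {x. absv x \<le> 1}"
    and A: "stable_series R A" and B: "stable_series R B"
  shows "stable_series R (tensor A B)"
proof -
  note iff = stable_series_iff[OF R(2)[folded unit_ball_def]]
  interpret U: coefficient_subring "fps_over unit_ball"
    by (intro coefficient_subring_fps_over unit_ball_subring)
  obtain \<phi> where A1: "fps_nth A 0 = 1" "A \<in> fps_over (fps_over R)"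
    and \<phi>: "\<And>t l. t \<noteq> 0 \<Longrightarrow> absv t < 1 \<Longrightarrow> gauss_max (eval_coeffs t A) (absv t powr l) (absv t powr \<phi> l)"
    using A unfolding iff one_plus_s_series_iff by blast
  obtain \<psi> where B1: "fps_nth B 0 = 1" "B \<in> fps_over (fps_over R)"
    and \<psi>: "\<And>t l. t \<noteq> 0 \<Longrightarrow> absv t < 1 \<Longrightarrow> gauss_max (eval_coeffs t B) (absv t powr l) (absv t powr \<psi> l)"
    using B unfolding iff one_plus_s_series_iff by blast
  obtain a b where ab: "A = exp_series a" "B = exp_series b"
    using exp_series_exists A1(1) B1(1) by metis
  define C where "C = tensor A B"
  have a: "power_sums A a" and b: "power_sums B b" and c: "power_sums C (\<lambda>k. a k * b k)"
    unfolding C_def ab tensor_exp_series by (rule power_sums_exp_series)+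
  have C1: "fps_nth C 0 = 1" "C \<in> fps_over (fps_over R)"
    using c tensor_integral[OF coefficient_subring_fps_over[OF R(1)] A1(2) B1(2) a b c]
    by (auto simp: power_sums_def)
  have ball: "A \<in> fps_over (fps_over unit_ball)" "B \<in> fps_over (fps_over unit_ball)"
      "C \<in> fps_over (fps_over unit_ball)"
    using A1(2) B1(2) C1(2) fps_over_mono[OF fps_over_mono[OF R(2)[folded unit_ball_def]]] by auto
  have ps: "power_sums (eval_coeffs t A) (\<lambda>k. eval_at t (a k))"
      "power_sums (eval_coeffs t B) (\<lambda>k. eval_at t (b k))"
      "power_sums (eval_coeffs t C) (\<lambda>k. eval_at t (a k) * eval_at t (b k))"
    if "absv t < 1" for t
  proof -
    show "power_sums (eval_coeffs t A) (\<lambda>k. eval_at t (a k))"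
        "power_sums (eval_coeffs t B) (\<lambda>k. eval_at t (b k))"
      using power_sums_eval_coeffs that a b ball by blast+
    show "power_sums (eval_coeffs t C) (\<lambda>k. eval_at t (a k) * eval_at t (b k))"
    proof (rule power_sums_cong[OF power_sums_eval_coeffs[OF c ball(3) that]])
      fix k
      show "eval_at t (a (Suc k) * b (Suc k)) = eval_at t (a (Suc k)) * eval_at t (b (Suc k))"
        using U.power_sums_mem[OF a ball(1)] U.power_sums_mem[OF b ball(2)] that
        by (intro eval_at_mult) auto
    qed
  qed
  define t0 where "t0 = (of_nat p :: 'c)"
  have t0: "t0 \<noteq> 0" "absv t0 < 1"
    using absv_p_power[of 1] prime_gt_1_nat[OF prime_p] by (auto simp: t0_def)
  have "\<exists>m. \<forall>t. t \<noteq> 0 \<longrightarrow> absv t < 1 \<longrightarrow> gauss_max (eval_coeffs t C) (absv t powr l) (absv t powr m)" for l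
  proof -
    \<comment> \<open>The bound leaves room for the transforms at l and at \<open>l - 1\<close>.\<close>
    define \<Lambda> where "\<Lambda> = max 0 (max (1 - l - \<phi> 0) (1 - l - \<psi> 0))"
    have AB0: "fps_nth (eval_coeffs t0 A) 0 = 1" "fps_nth (eval_coeffs t0 B) 0 = 1"
      using ps(1,2)[OF t0(2)] by (auto simp: power_sums_def)
    have pos: "absv t0 > 0"
      using t0 by simp
    obtain P d \<alpha> where "\<And>m. P m = (\<Prod>i<(d m :: nat). 1 - fps_const (\<alpha> m i) * fps_X)"
        "\<And>m i. \<alpha> m i \<noteq> (0 :: 'c)" "\<And>i. (\<lambda>m. fps_nth (P m) i) \<longlonglongrightarrow> fps_nth (eval_coeffs t0 A) i"
        and u: "\<And>m l. l \<ge> - \<Lambda> \<Longrightarrow> (\<Sum>i<d m. min 0 (l + ln (absv (\<alpha> m i)) / ln (absv t0))) = \<phi> l"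
      by (rule split_approximation_slopes[OF AB0(1) pos t0(2) \<phi>[OF t0], of \<Lambda>]) (rule that)
    obtain Q e \<beta> where "\<And>m. Q m = (\<Prod>i<(e m :: nat). 1 - fps_const (\<beta> m i) * fps_X)"
        "\<And>m i. \<beta> m i \<noteq> (0 :: 'c)" "\<And>i. (\<lambda>m. fps_nth (Q m) i) \<longlonglongrightarrow> fps_nth (eval_coeffs t0 B) i"
        and v: "\<And>m l. l \<ge> - \<Lambda> \<Longrightarrow> (\<Sum>i<e m. min 0 (l + ln (absv (\<beta> m i)) / ln (absv t0))) = \<psi> l"
      by (rule split_approximation_slopes[OF AB0(2) pos t0(2) \<psi>[OF t0], of \<Lambda>]) (rule that)
    define u v where "u = (\<lambda>i. ln (absv (\<alpha> 0 i)) / ln (absv t0))"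
      and "v = (\<lambda>i. ln (absv (\<beta> 0 i)) / ln (absv t0))"
    have "gauss_max (eval_coeffs t C) (absv t powr l)
        (absv t powr (\<Sum>i<d 0. \<Sum>j<e 0. min 0 (l + u i + v j)))" if t: "t \<noteq> 0" "absv t < 1" for t
      by (rule gauss_max_tensor[OF ps[OF t(2)] _ t(2) \<phi>[OF t] \<psi>[OF t], where \<Lambda> = \<Lambda>])
         (use t u v in \<open>auto simp: \<Lambda>_def u_def v_def\<close>)
    then show ?thesis
      by blast
  qed
  then obtain \<rho> where "\<And>l t. t \<noteq> 0 \<Longrightarrow> absv t < 1 \<Longrightarrow>
      gauss_max (eval_coeffs t C) (absv t powr l) (absv t powr \<rho> l)"
    by metis
  then show ?thesis
    unfolding C_def[symmetric] iff one_plus_s_series_iff using C1 by blast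
qed

end

theorem theorem1p5:
  fixes p q a :: nat
    and Zq :: "'c::{field_char_0, complete_space} set"
    and A B :: "'c fps fps"
  assumes "padic_complex_field TYPE('c) p"
    and "a > 0" and "q = p ^ a"
    and "is_Witt_subring p q Zq"
    and "stable_series Zq A" and "stable_series Zq B"
  shows "stable_series Zq (A * B) \<and> stable_series Zq (tensor A B)"
proof -
  have "coefficient_subring Zq" and "Zq \<subseteq> {x. absv x \<le> 1}"
    using assms(4) Witt_coefficient_subring by (auto simp: is_Witt_subring_def)
  note R = this
  show ?thesis
    by (intro conjI padic_complex_field.stable_series_mult[OF assms(1) R assms(5,6)]
        padic_complex_field.stable_series_tensor[OF assms(1) R assms(5,6)])
qed

end
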